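(* Let $G$ be a finite group, $K$ a field and $\alpha_K\in\operatorname{Aut}(K)$. Let $\mathcal{T}=(U,V,N)$ be a James triple in $G$ of index $k$, and let $f:V\to\mu(K)$ be a group morphism fitting $\mathcal{T}$ with respect to $\alpha_K$. Then the $KG$-module $$S^{\mathcal{T},f}_K\big/\bigl(S^{\mathcal{T},f}_K\cap (S^{\mathcal{T},f}_K)^{\perp}\bigr)$$ is absolutely irreducible or zero.
   Context: Conventions: maps are written on the right, $U^h=h^{-1}Uh$, $wN=\{wn: n\in N\}$, $UV=\{uv:u\in U,v\in V\}$; modules are right modules. $\mu(K)$ is the group of roots of unity in $K$. For $\lambda\in K$ write $\bar\lambda=\lambda\alpha_K$. James triple: for $k\in\mathbb{Z}_{\geq 2}$, a James triple in $G$ of index $k$ is a triple $(U,V,N)$ of subgroups of $G$ such that (J1) $U\cap V\leq N$; (J2) $N$ is a normal subgroup of $V$ with $|V/N|=k$; (J3) for all $h\in G\setminus(UV)$ and all $w\in V$ one has $|wN\cap U^h|=|N\cap U^h|$. Fitting: a group morphism $f:V\to\mu(K)$ fits $(U,V,N)$ with respect to $\alpha_K$ if (1) $\overline{vf}=(vf)^{-1}$ for all $v\in V$; and (2) if $\operatorname{char}(K)$ does not divide $|V/N|$, then $N\leq\ker(f)<V$ (proper subgroup), while if $\operatorname{char}(K)$ divides $|V/N|$, then $N\leq\ker(f)\leq V$. $M_K=K(U\backslash G)$ is the permutation $KG$-module with $K$-basis the right cosets $Ug$, $g\in G$, on which $G$ acts by right multiplication. It carries the $G$-invariant sesquilinear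 form $[-,=]$ ($K$-linear in the first argument, $\alpha_K$-semilinear in the second) with $[Ug,Uh]=1$ if $Ug=Uh$ and $0$ otherwise. $S^{\mathcal{T},f}_K\le M_K$ is the $KG$-submodule generated by $\sum_{v\in V}(vf)\,Uv$, and $(S^{\mathcal{T},f}_K)^\perp=\{x\in M_K:[x,s]=0\text{ for all }s\in S^{\mathcal{T},f}_K\}$. A $KG$-module is absolutely irreducible if it is irreducible and remains irreducible after extending scalars to an algebraic closure of $K$. *)

theory Defs
  imports "HOL-Algebra.Algebra" "HOL-Algebra.Algebraic_Closure_Type"
begin

section \<open>Modules over a group algebra\<close>

text \<open>
  A right module over the group algebra of \<open>G\<close> over the field \<open>'k\<close> is encoded as a \<open>'k\<close>-module in
  the sense of \<^theory>\<open>HOL-Algebra.Module\<close> together with a linear right action of \<open>G\<close>; the action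
  of the group algebra is its linear extension.  The fields \<open>mult\<close> and \<open>one\<close>, which the library's
  module record inherits from rings, carry no information.
\<close>

record ('k, 'm, 'g) kG_module = "('k, 'm) module" +
  gact :: "'m \<Rightarrow> 'g \<Rightarrow> 'm" (infixl \<open>\<star>\<index>\<close> 70)

locale kG_module =
  G: group G + M: module "ring_of_type_algebra :: 'k ring" M
  for G :: "('g, 'b) monoid_scheme" and M :: "('k::field, 'm, 'g) kG_module" +
  assumes gact_closed:
      "\<lbrakk>x \<in> carrier M; g \<in> carrier G\<rbrakk> \<Longrightarrow> x \<star>\<^bsub>M\<^esub> g \<in> carrier M"
    and gact_add:
      "\<lbrakk>x \<in> carrier M; y \<in> carrier M; g \<in> carrier G\<rbrakk>
        \<Longrightarrow> (x \<oplus>\<^bsub>M\<^esub> y) \<star>\<^bsub>M\<^esub> g = x \<star>\<^bsub>M\<^esub> g \<oplus>\<^bsub>M\<^esub> y \<star>\<^bsub>M\<^esub> g"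
    and gact_smult:
      "\<lbrakk>x \<in> carrier M; g \<in> carrier G\<rbrakk> \<Longrightarrow> (c \<odot>\<^bsub>M\<^esub> x) \<star>\<^bsub>M\<^esub> g = c \<odot>\<^bsub>M\<^esub> (x \<star>\<^bsub>M\<^esub> g)"
    and gact_one:
      "x \<in> carrier M \<Longrightarrow> x \<star>\<^bsub>M\<^esub> \<one>\<^bsub>G\<^esub> = x"
    and gact_mult:
      "\<lbrakk>x \<in> carrier M; g \<in> carrier G; h \<in> carrier G\<rbrakk>
        \<Longrightarrow> x \<star>\<^bsub>M\<^esub> (g \<otimes>\<^bsub>G\<^esub> h) = (x \<star>\<^bsub>M\<^esub> g) \<star>\<^bsub>M\<^esub> h"

locale kG_submodule =
  submodule H "ring_of_type_algebra :: 'k ring" M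
  for H :: "'m set" and G :: "('g, 'b) monoid_scheme" and M :: "('k::field, 'm, 'g) kG_module" +
  assumes gact_closed: "\<lbrakk>x \<in> H; g \<in> carrier G\<rbrakk> \<Longrightarrow> x \<star>\<^bsub>M\<^esub> g \<in> H"

definition kG_span ::
  "('g, 'b) monoid_scheme \<Rightarrow> ('k::field, 'm, 'g) kG_module \<Rightarrow> 'm set \<Rightarrow> 'm set" where
  "kG_span G M A = \<Inter>{H. kG_submodule H G M \<and> A \<subseteq> H}"

text \<open>
  As for the library's quotient rings, the elements of the quotient are the additive cosets of \<open>H\<close>,
  and the operations take unions over representatives.
\<close>

definition kG_quotient ::
  "('k::field, 'm, 'g) kG_module \<Rightarrow> 'm set \<Rightarrow> ('k, 'm set, 'g) kG_module" where
  "kG_quotient M H =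
    \<lparr>carrier = a_rcosets\<^bsub>M\<^esub> H, monoid.mult = undefined, one = undefined,
     ring.zero = H, add = set_add M,
     module.smult = (\<lambda>c A. \<Union>x\<in>A. H +>\<^bsub>M\<^esub> (c \<odot>\<^bsub>M\<^esub> x)),
     gact = (\<lambda>A g. \<Union>x\<in>A. H +>\<^bsub>M\<^esub> (x \<star>\<^bsub>M\<^esub> g))\<rparr>"

definition irreducible_kG_module ::
  "('g, 'b) monoid_scheme \<Rightarrow> ('k::field, 'm, 'g) kG_module \<Rightarrow> bool" where
  "irreducible_kG_module G M \<longleftrightarrow>
     kG_module G M \<and> carrier M \<noteq> {\<zero>\<^bsub>M\<^esub>} \<and>
     (\<forall>H. kG_submodule H G M \<longrightarrow> H = {\<zero>\<^bsub>M\<^esub>} \<or> H = carrier M)"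

section \<open>Permutation modules and extension of scalars\<close>

text \<open>
  The module with basis a right \<open>G\<close>-set \<open>\<Omega>\<close> with action \<open>act\<close>.  The element \<open>\<Sum>x. p x * x\<close> is
  encoded as the finitely supported coefficient function \<open>p\<close>; since the coefficient of \<open>x\<close> in \<open>p\<close>
  becomes that of \<open>act x g\<close> in the translate by \<open>g\<close>, the action on coefficients involves \<open>inv g\<close>.
\<close>

definition perm_module ::
  "('g, 'b) monoid_scheme \<Rightarrow> 'x set \<Rightarrow> ('x \<Rightarrow> 'g \<Rightarrow> 'x) \<Rightarrow> ('k::field, 'x \<Rightarrow> 'k, 'g) kG_module" where
  "perm_module G \<Omega> act =
    \<lparr>carrier = {p. finite {x. p x \<noteq> 0} \<and> {x. p x \<noteq> 0} \<subseteq> \<Omega>},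
     monoid.mult = undefined, one = undefined,
     ring.zero = (\<lambda>_. 0), add = (\<lambda>p q x. p x + q x),
     module.smult = (\<lambda>c p x. c * p x),
     gact = (\<lambda>p g x. if x \<in> \<Omega> then p (act x (inv\<^bsub>G\<^esub> g)) else 0)\<rparr>"

definition basis_elem :: "'x \<Rightarrow> 'x \<Rightarrow> 'k::field" where
  "basis_elem x = (\<lambda>y. if y = x then 1 else 0)"

text \<open>
  For a field embedding \<open>\<iota>\<close> of \<open>'k\<close> into \<open>'l\<close>, the tensor product of \<open>'l\<close> and \<open>M\<close> over \<open>'k\<close> is the
  free \<open>'l\<close>-module on the set \<open>M\<close> modulo the relations that make \<open>x \<mapsto> 1 \<otimes> x\<close> a \<open>'k\<close>-linear map.
  The set of relations is stable under \<open>G\<close>, so that its span as a \<open>G\<close>-module is its \<open>'l\<close>-linear span.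
\<close>

definition tensor_relations ::
  "('k::field \<Rightarrow> 'l::field) \<Rightarrow> ('k, 'm, 'g) kG_module \<Rightarrow> ('m \<Rightarrow> 'l) set" where
  "tensor_relations \<iota> M =
     {\<lambda>z. basis_elem (x \<oplus>\<^bsub>M\<^esub> y) z - basis_elem x z - basis_elem y z | x y.
        x \<in> carrier M \<and> y \<in> carrier M} \<union>
     {\<lambda>z. basis_elem (c \<odot>\<^bsub>M\<^esub> x) z - \<iota> c * basis_elem x z | c x. x \<in> carrier M}"

definition extend_scalars ::
  "('k::field \<Rightarrow> 'l::field) \<Rightarrow> ('g, 'b) monoid_scheme \<Rightarrow> ('k, 'm, 'g) kG_module
    \<Rightarrow> ('l, ('m \<Rightarrow> 'l) set, 'g) kG_module" where
  "extend_scalars \<iota> G M =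
    (let F = perm_module G (carrier M) (gact M)
     in kG_quotient F (kG_span G F (tensor_relations \<iota> M)))"

definition absolutely_irreducible_kG_module ::
  "('g, 'b) monoid_scheme \<Rightarrow> ('k::field, 'm, 'g) kG_module \<Rightarrow> bool" where
  "absolutely_irreducible_kG_module G M \<longleftrightarrow>
     irreducible_kG_module G M \<and>
     irreducible_kG_module G (extend_scalars (to_ac :: 'k \<Rightarrow> 'k alg_closure) G M)"

section \<open>James triples\<close>

definition james_triple ::
  "('g, 'b) monoid_scheme \<Rightarrow> nat \<Rightarrow> 'g set \<Rightarrow> 'g set \<Rightarrow> 'g set \<Rightarrow> bool" where
  "james_triple G k U V N \<longleftrightarrow>
     2 \<le> k \<and> subgroup U G \<and> subgroup V G \<and> subgroup N G \<and>
     U \<inter> V \<subseteq> N \<and>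
     N \<lhd> G\<lparr>carrier := V\<rparr> \<and> Coset.order (G\<lparr>carrier := V\<rparr> Mod N) = k \<and>
     (\<forall>h \<in> carrier G - (U <#>\<^bsub>G\<^esub> V). \<forall>w \<in> V.
        card ((w <#\<^bsub>G\<^esub> N) \<inter> ((inv\<^bsub>G\<^esub> h <#\<^bsub>G\<^esub> U) #>\<^bsub>G\<^esub> h)) =
        card (N \<inter> ((inv\<^bsub>G\<^esub> h <#\<^bsub>G\<^esub> U) #>\<^bsub>G\<^esub> h)))"

definition roots_of_unity :: "'k::field monoid" where
  "roots_of_unity =
    \<lparr>carrier = {x. \<exists>n>0. x ^ n = 1}, monoid.mult = (\<lambda>x y. x * y), one = 1\<rparr>"

definition fits ::
  "('g, 'b) monoid_scheme \<Rightarrow> ('k::field \<Rightarrow> 'k) \<Rightarrow> 'g set \<Rightarrow> 'g set \<Rightarrow> ('g \<Rightarrow> 'k) \<Rightarrow> bool" where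
  "fits G \<alpha> V N f \<longleftrightarrow>
     (\<forall>v\<in>V. \<alpha> (f v) = inverse (f v)) \<and>
     (let ker = kernel (G\<lparr>carrier := V\<rparr>) roots_of_unity f;
          k = Coset.order (G\<lparr>carrier := V\<rparr> Mod N)
      in (\<not> CHAR('k) dvd k \<longrightarrow> N \<subseteq> ker \<and> ker \<subset> V) \<and>
         (CHAR('k) dvd k \<longrightarrow> N \<subseteq> ker \<and> ker \<subseteq> V))"

definition coset_module ::
  "('g, 'b) monoid_scheme \<Rightarrow> 'g set \<Rightarrow> ('k::field, 'g set \<Rightarrow> 'k, 'g) kG_module" where
  "coset_module G U = perm_module G (rcosets\<^bsub>G\<^esub> U) (\<lambda>C g. C #>\<^bsub>G\<^esub> g)"

text \<open>The sesquilinear form for which the cosets are orthonormal, semilinear in the second argument.\<close>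

definition coset_form ::
  "('g, 'b) monoid_scheme \<Rightarrow> ('k::field \<Rightarrow> 'k) \<Rightarrow> 'g set \<Rightarrow> ('g set \<Rightarrow> 'k) \<Rightarrow> ('g set \<Rightarrow> 'k) \<Rightarrow> 'k" where
  "coset_form G \<alpha> U x y = (\<Sum>C\<in>rcosets\<^bsub>G\<^esub> U. x C * \<alpha> (y C))"

definition orth ::
  "('g, 'b) monoid_scheme \<Rightarrow> ('k::field \<Rightarrow> 'k) \<Rightarrow> 'g set \<Rightarrow> ('g set \<Rightarrow> 'k) set \<Rightarrow> ('g set \<Rightarrow> 'k) set" where
  "orth G \<alpha> U S = {x \<in> carrier (coset_module G U). \<forall>s\<in>S. coset_form G \<alpha> U x s = 0}"

definition james_generator ::
  "('g, 'b) monoid_scheme \<Rightarrow> 'g set \<Rightarrow> 'g set \<Rightarrow> ('g \<Rightarrow> 'k::field) \<Rightarrow> 'g set \<Rightarrow> 'k" where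
  "james_generator G U V f = (\<lambda>C. \<Sum>v\<in>V. f v * basis_elem (U #>\<^bsub>G\<^esub> v) C)"

definition james_submodule ::
  "('g, 'b) monoid_scheme \<Rightarrow> 'g set \<Rightarrow> 'g set \<Rightarrow> ('g \<Rightarrow> 'k::field) \<Rightarrow> ('g set \<Rightarrow> 'k) set" where
  "james_submodule G U V f = kG_span G (coset_module G U) {james_generator G U V f}"

end

theory Submission
  imports Defs
begin

text \<open>
  Write \<open>\<kappa> = \<Sum>v\<in>V. f v * v\<close>, an element of the group algebra, so that \<open>e = U\<kappa>\<close> is the generator of the module \<open>S\<close>.
  The theorem rests on two properties of \<open>\<kappa>\<close>, which are those of the signed column sums in
  James's treatment of Specht modules.

  First, \<open>\<kappa>\<close> maps the whole permutation module \<open>M\<close> into the line \<open>K e\<close> (\<open>kappa_in_line\<close>).  A coset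
  \<open>Uv\<close> with \<open>v\<close> in \<open>V\<close> goes to \<open>inverse (f v) * e\<close>.  If \<open>h\<close> lies outside \<open>UV\<close>, each coefficient of \<open>Uh\<kappa>\<close> is zero or a
  multiple of the sum of \<open>f\<close> over \<open>V \<inter> inv h U h\<close>.  The condition on \<open>h\<close> in a James triple says that this
  intersection is spread evenly over the cosets of \<open>N\<close>, on which \<open>f\<close> is constant, so the sum is a
  multiple of the sum of \<open>f\<close> over \<open>V/N\<close>, which vanishes: either \<open>f\<close> is a nontrivial character, or the
  characteristic divides the order of \<open>V/N\<close> (\<open>sum_f_coset\<close>, \<open>sum_f_conjugate\<close>).

  Second, \<open>\<kappa>\<close> is self-adjoint for the form, because \<open>\<alpha>\<close> inverts the values of \<open>f\<close>; hence \<open>[y, e]\<close> is the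
  coefficient of \<open>y\<kappa>\<close> at the coset \<open>U\<close> (\<open>form_gen\<close>).

  Let \<open>Q = S/(S \<inter> S')\<close>, where \<open>S'\<close> is the orthogonal space of \<open>S\<close>, and suppose that \<open>Q\<close> is nonzero,
  so that \<open>e\<close> is not in \<open>S'\<close>.  Then \<open>Q\<close> is generated by the image of \<open>e\<close>, \<open>\<kappa>\<close> maps \<open>Q\<close> into the line of that image, and no nonzero \<open>x\<close> satisfies \<open>xg\<kappa> = 0\<close> for
  all \<open>g\<close>.  These three properties are collected in the locale \<open>rank_one_kG_module\<close> and force
  irreducibility: in a nonzero submodule some \<open>xg\<kappa>\<close> is a nonzero multiple of \<open>e\<close>, hence \<open>e\<close> lies in it.

  The same properties survive extension of scalars.  Only the last one needs an argument.  Let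
  \<open>\<lambda> x\<close> be the scalar with \<open>x\<kappa> = \<lambda> x e\<close>.  Since the functionals \<open>x \<mapsto> \<lambda> (xg)\<close> separate the points of \<open>Q\<close>,
  a minimal separating set of elements \<open>g\<close> has a dual basis in \<open>Q\<close> (\<open>dual_basis\<close>), and therefore the
  extended functionals separate the points of the tensor product.  In terms of the presentation of the
  tensor product by generators and relations, the span of the relations is exactly the common kernel of the
  extended functionals (\<open>irreducible_extend_scalars\<close>).
\<close>

section \<open>Modules over a group algebra\<close>

lemma ring_of_type_algebra_simps [simp]:
  "carrier (ring_of_type_algebra :: 'k::field ring) = UNIV"
  "\<zero>\<^bsub>ring_of_type_algebra\<^esub> = (0 :: 'k)"
  "\<one>\<^bsub>ring_of_type_algebra\<^esub> = (1 :: 'k)"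
  "a \<oplus>\<^bsub>ring_of_type_algebra\<^esub> b = (a + b :: 'k)"
  "a \<otimes>\<^bsub>ring_of_type_algebra\<^esub> b = (a * b :: 'k)"
  by (simp_all add: ring_of_type_algebra_def)

text \<open>
  The law \<open>0 \<odot> x = \<zero>\<close> stands in for the existence of negatives, since it makes \<open>(-1) \<odot> x\<close> the negative
  of \<open>x\<close>.
\<close>

lemma kG_moduleI:
  fixes M (structure)
  assumes "group G"
    and "\<And>x y. \<lbrakk>x \<in> carrier M; y \<in> carrier M\<rbrakk> \<Longrightarrow> x \<oplus> y \<in> carrier M"
    and "\<zero> \<in> carrier M"
    and "\<And>x y z. \<lbrakk>x \<in> carrier M; y \<in> carrier M; z \<in> carrier M\<rbrakk> \<Longrightarrow> (x \<oplus> y) \<oplus> z = x \<oplus> (y \<oplus> z)"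
    and "\<And>x y. \<lbrakk>x \<in> carrier M; y \<in> carrier M\<rbrakk> \<Longrightarrow> x \<oplus> y = y \<oplus> x"
    and "\<And>x. x \<in> carrier M \<Longrightarrow> \<zero> \<oplus> x = x"
    and "\<And>a x. x \<in> carrier M \<Longrightarrow> a \<odot> x \<in> carrier M"
    and "\<And>a b x. x \<in> carrier M \<Longrightarrow> (a + b) \<odot> x = a \<odot> x \<oplus> b \<odot> x"
    and "\<And>a x y. \<lbrakk>x \<in> carrier M; y \<in> carrier M\<rbrakk> \<Longrightarrow> a \<odot> (x \<oplus> y) = a \<odot> x \<oplus> a \<odot> y"
    and "\<And>a b x. x \<in> carrier M \<Longrightarrow> (a * b) \<odot> x = a \<odot> (b \<odot> x)"
    and "\<And>x. x \<in> carrier M \<Longrightarrow> 1 \<odot> x = x"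
    and "\<And>x. x \<in> carrier M \<Longrightarrow> 0 \<odot> x = \<zero>"
    and "\<And>x g. \<lbrakk>x \<in> carrier M; g \<in> carrier G\<rbrakk> \<Longrightarrow> x \<star> g \<in> carrier M"
    and "\<And>x y g. \<lbrakk>x \<in> carrier M; y \<in> carrier M; g \<in> carrier G\<rbrakk> \<Longrightarrow> (x \<oplus> y) \<star> g = x \<star> g \<oplus> y \<star> g"
    and "\<And>a x g. \<lbrakk>x \<in> carrier M; g \<in> carrier G\<rbrakk> \<Longrightarrow> (a \<odot> x) \<star> g = a \<odot> (x \<star> g)"
    and "\<And>x. x \<in> carrier M \<Longrightarrow> x \<star> \<one>\<^bsub>G\<^esub> = x"
    and "\<And>x g h. \<lbrakk>x \<in> carrier M; g \<in> carrier G; h \<in> carrier G\<rbrakk>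
           \<Longrightarrow> x \<star> (g \<otimes>\<^bsub>G\<^esub> h) = (x \<star> g) \<star> h"
  shows "kG_module G (M :: ('k::field, 'm, 'g) kG_module)"
proof -
  have neg: "\<exists>y \<in> carrier M. y \<oplus> x = \<zero>" if x: "x \<in> carrier M" for x
  proof
    have "(-1) \<odot> x \<oplus> x = (-1 + 1) \<odot> x"
      unfolding assms(8)[OF x] by (simp add: assms(11)[OF x])
    then show "(-1) \<odot> x \<oplus> x = \<zero>"
      by (simp add: assms(12)[OF x])
  qed (use x assms(7) in auto)
  have "abelian_group M"
    by (rule abelian_groupI) (use assms neg in auto)
  then show ?thesis
    by (intro kG_module.intro kG_module_axioms.intro moduleI cring_from_type_algebra)
       (use assms in auto)
qed

context kG_module
begin

lemma smult_in [simp, intro]: "x \<in> carrier M \<Longrightarrow> a \<odot>\<^bsub>M\<^esub> x \<in> carrier M"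
  using M.smult_closed[of a x] by simp

lemma smult_add_left: "x \<in> carrier M \<Longrightarrow> (a + b) \<odot>\<^bsub>M\<^esub> x = a \<odot>\<^bsub>M\<^esub> x \<oplus>\<^bsub>M\<^esub> b \<odot>\<^bsub>M\<^esub> x"
  using M.smult_l_distr[of a b x] by simp

lemma smult_add_right:
  "\<lbrakk>x \<in> carrier M; y \<in> carrier M\<rbrakk> \<Longrightarrow> a \<odot>\<^bsub>M\<^esub> (x \<oplus>\<^bsub>M\<^esub> y) = a \<odot>\<^bsub>M\<^esub> x \<oplus>\<^bsub>M\<^esub> a \<odot>\<^bsub>M\<^esub> y"
  using M.smult_r_distr[of a x y] by simp

lemma smult_smult: "x \<in> carrier M \<Longrightarrow> a \<odot>\<^bsub>M\<^esub> (b \<odot>\<^bsub>M\<^esub> x) = (a * b) \<odot>\<^bsub>M\<^esub> x"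
  using M.smult_assoc1[of a b x] by simp

lemma smult_one_left [simp]: "x \<in> carrier M \<Longrightarrow> 1 \<odot>\<^bsub>M\<^esub> x = x"
  using M.smult_one[of x] by simp

lemma smult_zero_left [simp]: "x \<in> carrier M \<Longrightarrow> 0 \<odot>\<^bsub>M\<^esub> x = \<zero>\<^bsub>M\<^esub>"
  using M.smult_l_null[of x] by simp

lemma smult_zero_right [simp]: "a \<odot>\<^bsub>M\<^esub> \<zero>\<^bsub>M\<^esub> = \<zero>\<^bsub>M\<^esub>"
  using M.smult_r_null[of a] by simp

lemma minus_eq_smult: "x \<in> carrier M \<Longrightarrow> \<ominus>\<^bsub>M\<^esub> x = (-1) \<odot>\<^bsub>M\<^esub> x"
  by (rule M.minus_equality) (use smult_add_left[of x "-1" 1] in auto)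

lemma smult_eq_zero_iff:
  assumes "x \<in> carrier M" shows "a \<odot>\<^bsub>M\<^esub> x = \<zero>\<^bsub>M\<^esub> \<longleftrightarrow> a = 0 \<or> x = \<zero>\<^bsub>M\<^esub>"
proof -
  have "x = \<zero>\<^bsub>M\<^esub>" if "a \<odot>\<^bsub>M\<^esub> x = \<zero>\<^bsub>M\<^esub>" "a \<noteq> 0"
    using smult_smult[OF assms, of "inverse a" a] that assms by simp
  then show ?thesis using assms by auto
qed

lemma kG_submoduleI:
  assumes "H \<subseteq> carrier M" and "\<zero>\<^bsub>M\<^esub> \<in> H"
    and "\<And>x y. \<lbrakk>x \<in> H; y \<in> H\<rbrakk> \<Longrightarrow> x \<oplus>\<^bsub>M\<^esub> y \<in> H"
    and "\<And>a x. x \<in> H \<Longrightarrow> a \<odot>\<^bsub>M\<^esub> x \<in> H"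
    and "\<And>x g. \<lbrakk>x \<in> H; g \<in> carrier G\<rbrakk> \<Longrightarrow> x \<star>\<^bsub>M\<^esub> g \<in> H"
  shows "kG_submodule H G M"
  by (intro kG_submodule.intro kG_submodule_axioms.intro M.submoduleI)
     (use assms minus_eq_smult in auto)

lemma kG_submoduleD:
  assumes "kG_submodule H G M"
  shows "H \<subseteq> carrier M" and "\<zero>\<^bsub>M\<^esub> \<in> H"
    and "\<And>x y. \<lbrakk>x \<in> H; y \<in> H\<rbrakk> \<Longrightarrow> x \<oplus>\<^bsub>M\<^esub> y \<in> H"
    and "\<And>a x. x \<in> H \<Longrightarrow> a \<odot>\<^bsub>M\<^esub> x \<in> H"
    and "\<And>x g. \<lbrakk>x \<in> H; g \<in> carrier G\<rbrakk> \<Longrightarrow> x \<star>\<^bsub>M\<^esub> g \<in> H"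
    and "\<And>x. x \<in> H \<Longrightarrow> \<ominus>\<^bsub>M\<^esub> x \<in> H"
proof -
  interpret H: kG_submodule H G M by fact
  note sub = H.submodule_axioms
  show "H \<subseteq> carrier M" and "\<And>x y. \<lbrakk>x \<in> H; y \<in> H\<rbrakk> \<Longrightarrow> x \<oplus>\<^bsub>M\<^esub> y \<in> H"
    and "\<And>x. x \<in> H \<Longrightarrow> \<ominus>\<^bsub>M\<^esub> x \<in> H"
    using M.submoduleE[OF sub] by auto
  show "\<And>a x. x \<in> H \<Longrightarrow> a \<odot>\<^bsub>M\<^esub> x \<in> H" using H.smult_closed by simp
  show "\<And>x g. \<lbrakk>x \<in> H; g \<in> carrier G\<rbrakk> \<Longrightarrow> x \<star>\<^bsub>M\<^esub> g \<in> H" by (rule H.gact_closed)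
  show "\<zero>\<^bsub>M\<^esub> \<in> H" using H.one_closed by simp
qed

lemma finsum_in_kG_submodule:
  assumes "kG_submodule H G M" "\<And>i. i \<in> I \<Longrightarrow> t i \<in> H"
  shows "finsum M t I \<in> H"
proof (cases "finite I")
  case True
  then show ?thesis
    using assms(2)
  proof (induction I)
    case (insert i I)
    then have "t i \<in> carrier M" "t \<in> I \<rightarrow> carrier M"
      using kG_submoduleD(1)[OF assms(1)] by auto
    then show ?case using insert kG_submoduleD(3)[OF assms(1)] by simp
  qed (use kG_submoduleD(2)[OF assms(1)] in simp)
qed (use kG_submoduleD(2)[OF assms(1)] in simp)

lemma kG_module_restrict:
  assumes "kG_submodule H G M" shows "kG_module G (M\<lparr>carrier := H\<rparr>)"
proof -
  note D = kG_submoduleD[OF assms]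
  have [simp]: "x \<in> H \<Longrightarrow> x \<in> carrier M" for x using D(1) by auto
  show ?thesis
    by (rule kG_moduleI)
       (auto simp: D G.group_axioms M.a_ac smult_add_left smult_add_right smult_smult
           gact_add gact_smult gact_one gact_mult)
qed

lemma kG_submodule_restrict_iff:
  assumes "kG_submodule S G M"
  shows "kG_submodule H G (M\<lparr>carrier := S\<rparr>) \<longleftrightarrow> kG_submodule H G M \<and> H \<subseteq> S"
proof -
  interpret S: kG_module G "M\<lparr>carrier := S\<rparr>" by (rule kG_module_restrict) fact
  show ?thesis
  proof
    assume H: "kG_submodule H G (M\<lparr>carrier := S\<rparr>)"
    show "kG_submodule H G M \<and> H \<subseteq> S"
      using S.kG_submoduleD[OF H] kG_submoduleD(1)[OF assms] by (auto intro!: kG_submoduleI)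
  next
    assume H: "kG_submodule H G M \<and> H \<subseteq> S"
    then show "kG_submodule H G (M\<lparr>carrier := S\<rparr>)"
      using kG_submoduleD[of H] by (auto intro!: S.kG_submoduleI)
  qed
qed

lemma kG_submodule_Int:
  assumes "kG_submodule H G M" "kG_submodule H' G M" shows "kG_submodule (H \<inter> H') G M"
  using kG_submoduleD[OF assms(1)] kG_submoduleD[OF assms(2)] by (auto intro!: kG_submoduleI)

lemma kG_submodule_carrier: "kG_submodule (carrier M) G M"
  by (rule kG_submoduleI) (auto intro: gact_closed)

lemma kG_submodule_span:
  assumes "A \<subseteq> carrier M" shows "kG_submodule (kG_span G M A) G M"
  unfolding kG_span_def
proof (rule kG_submoduleI)
  show "\<Inter> {H. kG_submodule H G M \<and> A \<subseteq> H} \<subseteq> carrier M"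
    using kG_submodule_carrier assms by auto
qed (auto intro: kG_submoduleD)

end

lemma subset_kG_span: "A \<subseteq> kG_span G M A"
  by (auto simp: kG_span_def)

lemma kG_span_subset: "\<lbrakk>kG_submodule H G M; A \<subseteq> H\<rbrakk> \<Longrightarrow> kG_span G M A \<subseteq> H"
  by (auto simp: kG_span_def)

section \<open>Quotient modules\<close>

context kG_module
begin

context
  fixes H assumes H: "kG_submodule H G M"
begin

lemma abelian_subgroup_kG_submodule: "abelian_subgroup H M"
proof -
  interpret H: kG_submodule H G M by fact
  show ?thesis
    by (intro abelian_subgroupI3 additive_subgroupI H.subgroup_axioms M.abelian_group_axioms)
qed

interpretation A: abelian_subgroup H M by (rule abelian_subgroup_kG_submodule)

lemma coset_eq_iff:
  assumes "x \<in> carrier M" "y \<in> carrier M"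
  shows "H +>\<^bsub>M\<^esub> x = H +>\<^bsub>M\<^esub> y \<longleftrightarrow> x \<ominus>\<^bsub>M\<^esub> y \<in> H"
proof -
  have "H +>\<^bsub>M\<^esub> x = H +>\<^bsub>M\<^esub> y \<longleftrightarrow> x \<in> H +>\<^bsub>M\<^esub> y"
    using A.a_repr_independence'[of x y] A.a_rcos_self[of x] assms by auto
  then show ?thesis using A.a_rcos_module[of y x] assms by (simp add: a_minus_def)
qed

lemma coset_eq_self_iff: "x \<in> carrier M \<Longrightarrow> H +>\<^bsub>M\<^esub> x = H \<longleftrightarrow> x \<in> H"
  using coset_eq_iff[of x "\<zero>\<^bsub>M\<^esub>"] kG_submoduleD(1)[OF H]
  by (simp add: M.minus_eq minus_eq_smult)

text \<open>
  The operations of \<open>kG_quotient\<close> are unions over all representatives of a coset; they agree with the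
  operation on any single representative because that operation respects congruence modulo \<open>H\<close>.
\<close>

lemma coset_UN:
  assumes "x \<in> carrier M" and t: "\<And>y. y \<in> carrier M \<Longrightarrow> t y \<in> carrier M"
    and *: "\<And>y. y \<in> carrier M \<Longrightarrow> y \<ominus>\<^bsub>M\<^esub> x \<in> H \<Longrightarrow> t y \<ominus>\<^bsub>M\<^esub> t x \<in> H"
  shows "(\<Union>y \<in> H +>\<^bsub>M\<^esub> x. H +>\<^bsub>M\<^esub> t y) = H +>\<^bsub>M\<^esub> t x"
proof -
  have "H +>\<^bsub>M\<^esub> t y = H +>\<^bsub>M\<^esub> t x" if "y \<in> H +>\<^bsub>M\<^esub> x" for y
  proof -
    have y: "y \<in> carrier M" using A.a_elemrcos_carrier assms(1) that by blast
    then have "y \<ominus>\<^bsub>M\<^esub> x \<in> H" using A.a_rcos_module_imp[of x y] assms(1) that by (simp add: a_minus_def)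
    then show ?thesis using * y t assms(1) by (simp add: coset_eq_iff)
  qed
  moreover have "x \<in> H +>\<^bsub>M\<^esub> x" using A.a_rcos_self assms(1) by simp
  ultimately show ?thesis by blast
qed

lemma smult_minus: "x \<in> carrier M \<Longrightarrow> y \<in> carrier M \<Longrightarrow> a \<odot>\<^bsub>M\<^esub> (x \<ominus>\<^bsub>M\<^esub> y) = a \<odot>\<^bsub>M\<^esub> x \<ominus>\<^bsub>M\<^esub> a \<odot>\<^bsub>M\<^esub> y"
  by (simp add: a_minus_def minus_eq_smult smult_add_right smult_smult mult.commute)

lemma gact_minus: "x \<in> carrier M \<Longrightarrow> y \<in> carrier M \<Longrightarrow> g \<in> carrier G \<Longrightarrow>
  (x \<ominus>\<^bsub>M\<^esub> y) \<star>\<^bsub>M\<^esub> g = x \<star>\<^bsub>M\<^esub> g \<ominus>\<^bsub>M\<^esub> y \<star>\<^bsub>M\<^esub> g"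
  by (simp add: a_minus_def minus_eq_smult gact_add gact_smult gact_closed)

lemma kG_quotient_sels:
  "carrier (kG_quotient M H) = (\<lambda>x. H +>\<^bsub>M\<^esub> x) ` carrier M"
  "\<zero>\<^bsub>kG_quotient M H\<^esub> = H"
  by (auto simp: kG_quotient_def A_RCOSETS_def')

lemma coset_add:
  assumes "x \<in> carrier M" "y \<in> carrier M"
  shows "(H +>\<^bsub>M\<^esub> x) \<oplus>\<^bsub>kG_quotient M H\<^esub> (H +>\<^bsub>M\<^esub> y) = H +>\<^bsub>M\<^esub> (x \<oplus>\<^bsub>M\<^esub> y)"
  using A.a_rcos_sum assms by (simp add: kG_quotient_def)

lemma coset_smult:
  assumes "x \<in> carrier M"
  shows "a \<odot>\<^bsub>kG_quotient M H\<^esub> (H +>\<^bsub>M\<^esub> x) = H +>\<^bsub>M\<^esub> (a \<odot>\<^bsub>M\<^esub> x)"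
  using coset_UN[OF assms, of "\<lambda>y. a \<odot>\<^bsub>M\<^esub> y"] kG_submoduleD(4)[OF H] assms
  by (simp add: kG_quotient_def flip: smult_minus)

lemma coset_gact:
  assumes "x \<in> carrier M" "g \<in> carrier G"
  shows "(H +>\<^bsub>M\<^esub> x) \<star>\<^bsub>kG_quotient M H\<^esub> g = H +>\<^bsub>M\<^esub> (x \<star>\<^bsub>M\<^esub> g)"
  using coset_UN[OF assms(1), of "\<lambda>y. y \<star>\<^bsub>M\<^esub> g"] kG_submoduleD(5)[OF H] assms
  by (simp add: kG_quotient_def gact_closed flip: gact_minus)

lemmas coset_simps = coset_add coset_smult coset_gact

lemma kG_module_quotient: "kG_module G (kG_quotient M H)"
proof -
  note S = kG_quotient_sels
  have zero: "\<zero>\<^bsub>kG_quotient M H\<^esub> = H +>\<^bsub>M\<^esub> \<zero>\<^bsub>M\<^esub>"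
    using coset_eq_self_iff[of "\<zero>\<^bsub>M\<^esub>"] kG_submoduleD(2)[OF H] by (simp add: S)
  show ?thesis
    by (rule kG_moduleI)
       (auto simp: S(1) zero coset_simps G.group_axioms M.a_ac smult_add_left
           smult_add_right smult_smult gact_closed gact_add gact_smult gact_one gact_mult)
qed

text \<open>
  A submodule of the quotient is determined by its preimage in \<open>M\<close>, which is again a submodule; this
  is how statements about submodules of the quotient are pulled back to \<open>M\<close>.
\<close>

lemma kG_submodule_preimage:
  assumes P': "kG_submodule P' G (kG_quotient M H)"
  shows "kG_submodule {x \<in> carrier M. H +>\<^bsub>M\<^esub> x \<in> P'} G M" (is "kG_submodule ?P G M")
proof (rule kG_submoduleI)
  interpret Q: kG_module G "kG_quotient M H" by (rule kG_module_quotient)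
  note D = Q.kG_submoduleD[OF P']
  show "\<zero>\<^bsub>M\<^esub> \<in> ?P"
    using D(2) coset_eq_self_iff[of "\<zero>\<^bsub>M\<^esub>"] kG_submoduleD(2)[OF H] by (simp add: kG_quotient_sels)
  show "x \<oplus>\<^bsub>M\<^esub> y \<in> ?P" if "x \<in> ?P" "y \<in> ?P" for x y
    using D(3)[of "H +>\<^bsub>M\<^esub> x" "H +>\<^bsub>M\<^esub> y"] that by (simp add: coset_add)
  show "a \<odot>\<^bsub>M\<^esub> x \<in> ?P" if "x \<in> ?P" for a x
    using D(4)[of "H +>\<^bsub>M\<^esub> x" a] that by (simp add: coset_smult)
  show "x \<star>\<^bsub>M\<^esub> g \<in> ?P" if "x \<in> ?P" "g \<in> carrier G" for x g
    using D(5)[of "H +>\<^bsub>M\<^esub> x" g] that by (simp add: coset_gact gact_closed)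
qed auto

lemma irreducible_quotientI:
  assumes "H \<noteq> carrier M"
    and max: "\<And>P. \<lbrakk>kG_submodule P G M; H \<subseteq> P; P \<noteq> H\<rbrakk> \<Longrightarrow> P = carrier M"
  shows "irreducible_kG_module G (kG_quotient M H)"
  unfolding irreducible_kG_module_def
proof (intro conjI allI impI)
  show "kG_module G (kG_quotient M H)" by (rule kG_module_quotient)
  interpret Q: kG_module G "kG_quotient M H" by (rule kG_module_quotient)
  note S = kG_quotient_sels
  obtain x where "x \<in> carrier M" "x \<notin> H"
    using assms(1) kG_submoduleD(1)[OF H] by auto
  then show "carrier (kG_quotient M H) \<noteq> {\<zero>\<^bsub>kG_quotient M H\<^esub>}"
    using coset_eq_self_iff[of x] by (auto simp: S)
  fix P' assume P': "kG_submodule P' G (kG_quotient M H)"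
  note D = Q.kG_submoduleD[OF P']
  define P where "P = {x \<in> carrier M. H +>\<^bsub>M\<^esub> x \<in> P'}"
  have P: "kG_submodule P G M" unfolding P_def by (rule kG_submodule_preimage) (rule P')
  have "H +>\<^bsub>M\<^esub> x = H" if "x \<in> H" for x
    using coset_eq_self_iff[of x] that kG_submoduleD(1)[OF H] by auto
  then have HP: "H \<subseteq> P"
    using D(2) kG_submoduleD(1)[OF H] by (auto simp: P_def S)
  have P'_eq: "P' = (\<lambda>x. H +>\<^bsub>M\<^esub> x) ` P"
    using D(1) by (auto simp: P_def S)
  show "P' = {\<zero>\<^bsub>kG_quotient M H\<^esub>} \<or> P' = carrier (kG_quotient M H)"
  proof (cases "P = H")
    case True
    then have "P' \<subseteq> {H}"
      using P'_eq coset_eq_self_iff kG_submoduleD(1)[OF H] by auto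
    then show ?thesis using D(2) S by auto
  next
    case False
    then show ?thesis using max[OF P HP] P'_eq by (simp add: S)
  qed
qed

lemma coset_finsum:
  assumes "\<And>i. i \<in> I \<Longrightarrow> t i \<in> carrier M"
  shows "H +>\<^bsub>M\<^esub> finsum M t I = finsum (kG_quotient M H) (\<lambda>i. H +>\<^bsub>M\<^esub> t i) I"
proof -
  interpret Q: kG_module G "kG_quotient M H" by (rule kG_module_quotient)
  have zero: "H +>\<^bsub>M\<^esub> \<zero>\<^bsub>M\<^esub> = \<zero>\<^bsub>kG_quotient M H\<^esub>"
    using coset_eq_self_iff[of "\<zero>\<^bsub>M\<^esub>"] kG_submoduleD(2)[OF H] by (simp add: kG_quotient_sels)
  show ?thesis
  proof (cases "finite I")
    case True
    then show ?thesis using assms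
    proof (induction I)
      case (insert i I)
      have [simp]: "finsum M t I \<in> carrier M" using insert by (intro M.finsum_closed) auto
      have "H +>\<^bsub>M\<^esub> finsum M t (insert i I) = H +>\<^bsub>M\<^esub> (t i \<oplus>\<^bsub>M\<^esub> finsum M t I)"
        using insert by (subst M.finsum_insert) auto
      also have "\<dots> = (H +>\<^bsub>M\<^esub> t i) \<oplus>\<^bsub>kG_quotient M H\<^esub> finsum (kG_quotient M H) (\<lambda>i. H +>\<^bsub>M\<^esub> t i) I"
        using insert by (simp add: coset_add[symmetric])
      also have "\<dots> = finsum (kG_quotient M H) (\<lambda>i. H +>\<^bsub>M\<^esub> t i) (insert i I)"
        using insert by (subst Q.M.finsum_insert) (auto simp: kG_quotient_sels)
      finally show ?case .
    qed (simp add: zero)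
  qed (simp add: zero)
qed

end

end

section \<open>Permutation modules\<close>

lemma perm_module_sels [simp]:
  "p \<oplus>\<^bsub>perm_module G \<Omega> act\<^esub> q = (\<lambda>x. p x + q x)"
  "\<zero>\<^bsub>perm_module G \<Omega> act\<^esub> = (\<lambda>_. 0)"
  "a \<odot>\<^bsub>perm_module G \<Omega> act\<^esub> p = (\<lambda>x. a * p x)"
  by (simp_all add: perm_module_def)

lemma perm_module_gact:
  "p \<star>\<^bsub>perm_module G \<Omega> act\<^esub> g = (\<lambda>x. if x \<in> \<Omega> then p (act x (inv\<^bsub>G\<^esub> g)) else 0)"
  by (simp add: perm_module_def)

lemma perm_module_carrier:
  "p \<in> carrier (perm_module G \<Omega> act) \<longleftrightarrow> finite {x. p x \<noteq> 0} \<and> {x. p x \<noteq> 0} \<subseteq> \<Omega>"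
  by (simp add: perm_module_def)

lemma basis_elem_in_carrier [simp]:
  "x \<in> \<Omega> \<Longrightarrow> basis_elem x \<in> carrier (perm_module G \<Omega> act)"
  by (auto simp: perm_module_carrier basis_elem_def)

text \<open>
  The value at \<open>p\<close> of the linear functional on the free module that takes the value \<open>\<phi> x\<close> at the basis element \<open>x\<close>.
\<close>

definition lin_ext :: "('x \<Rightarrow> 'l::field) \<Rightarrow> ('x \<Rightarrow> 'l) \<Rightarrow> 'l" where
  "lin_ext \<phi> p = (\<Sum>x | p x \<noteq> 0. p x * \<phi> x)"

lemma lin_ext_eq_sum:
  "\<lbrakk>finite A; {x. p x \<noteq> 0} \<subseteq> A\<rbrakk> \<Longrightarrow> lin_ext \<phi> p = (\<Sum>x\<in>A. p x * \<phi> x)"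
  unfolding lin_ext_def by (rule sum.mono_neutral_left) auto

lemma lin_ext_zero [simp]: "lin_ext \<phi> (\<lambda>_. 0) = 0"
  by (simp add: lin_ext_def)

lemma lin_ext_basis_elem [simp]: "lin_ext \<phi> (basis_elem x) = \<phi> x"
  by (subst lin_ext_eq_sum[of "{x}"]) (auto simp: basis_elem_def)

lemma lin_ext_add:
  assumes "finite {x. p x \<noteq> 0}" "finite {x. q x \<noteq> 0}"
  shows "lin_ext \<phi> (\<lambda>x. p x + q x) = lin_ext \<phi> p + lin_ext \<phi> q"
proof -
  let ?A = "{x. p x \<noteq> 0} \<union> {x. q x \<noteq> 0}"
  have "lin_ext \<phi> p = (\<Sum>x\<in>?A. p x * \<phi> x)" "lin_ext \<phi> q = (\<Sum>x\<in>?A. q x * \<phi> x)"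
    "lin_ext \<phi> (\<lambda>x. p x + q x) = (\<Sum>x\<in>?A. (p x + q x) * \<phi> x)"
    by (rule lin_ext_eq_sum; use assms in auto)+
  then show ?thesis by (simp add: distrib_right sum.distrib)
qed

lemma lin_ext_smult: "lin_ext \<phi> (\<lambda>x. a * p x) = a * lin_ext \<phi> p"
proof (cases "a = 0")
  case False
  then show ?thesis by (simp add: lin_ext_def sum_distrib_left mult.assoc)
qed simp

lemma lin_ext_diff:
  assumes "finite {x. p x \<noteq> 0}" "finite {x. q x \<noteq> 0}"
  shows "lin_ext \<phi> (\<lambda>x. p x - q x) = lin_ext \<phi> p - lin_ext \<phi> q"
proof -
  have "lin_ext \<phi> (\<lambda>x. p x - q x) = lin_ext \<phi> (\<lambda>x. p x + (-1) * q x)" by simp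
  also have "\<dots> = lin_ext \<phi> p + lin_ext \<phi> (\<lambda>x. (-1) * q x)"
    by (rule lin_ext_add) (use assms in auto)
  finally show ?thesis by (simp add: lin_ext_smult del: mult_minus_left mult_minus1)
qed

lemma lin_ext_fun_sum:
  "lin_ext (\<lambda>x. \<Sum>i\<in>I. a i * \<phi> i x) p = (\<Sum>i\<in>I. a i * lin_ext (\<phi> i) p)"
  unfolding lin_ext_def sum_distrib_left
  by (subst sum.swap) (simp add: algebra_simps)

lemma lin_ext_fun_smult: "lin_ext (\<lambda>x. a * \<phi> x) p = a * lin_ext \<phi> p"
  by (simp add: lin_ext_def sum_distrib_left algebra_simps)

locale right_action = group G for G :: "('g, 'b) monoid_scheme" (structure) +
  fixes \<Omega> :: "'x set" and act :: "'x \<Rightarrow> 'g \<Rightarrow> 'x"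
  assumes act_closed: "\<lbrakk>x \<in> \<Omega>; g \<in> carrier G\<rbrakk> \<Longrightarrow> act x g \<in> \<Omega>"
    and act_one: "x \<in> \<Omega> \<Longrightarrow> act x \<one> = x"
    and act_mult: "\<lbrakk>x \<in> \<Omega>; g \<in> carrier G; h \<in> carrier G\<rbrakk> \<Longrightarrow> act x (g \<otimes> h) = act (act x g) h"
begin

lemma act_inv [simp]:
  assumes "x \<in> \<Omega>" "g \<in> carrier G"
  shows "act (act x g) (inv g) = x" "act (act x (inv g)) g = x"
  using act_mult[of x g "inv g"] act_mult[of x "inv g" g] assms by (simp_all add: act_one)

lemma gact_support:
  fixes p :: "'x \<Rightarrow> 'k::field"
  assumes "p \<in> carrier (perm_module G \<Omega> act)" "g \<in> carrier G"
  shows "{x. (p \<star>\<^bsub>perm_module G \<Omega> act\<^esub> g) x \<noteq> 0} = (\<lambda>x. act x g) ` {x. p x \<noteq> 0}"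
proof (intro equalityI subsetI)
  fix x assume "x \<in> {x. (p \<star>\<^bsub>perm_module G \<Omega> act\<^esub> g) x \<noteq> 0}"
  then have "x \<in> \<Omega>" "p (act x (inv g)) \<noteq> 0" by (auto simp: perm_module_gact split: if_splits)
  then show "x \<in> (\<lambda>x. act x g) ` {x. p x \<noteq> 0}"
    using assms by (auto intro!: image_eqI[of _ _ "act x (inv g)"])
next
  fix x assume "x \<in> (\<lambda>x. act x g) ` {x. p x \<noteq> 0}"
  then show "x \<in> {x. (p \<star>\<^bsub>perm_module G \<Omega> act\<^esub> g) x \<noteq> 0}"
    using assms by (auto simp: perm_module_gact perm_module_carrier act_closed)
qed

lemma kG_module_perm: "kG_module G (perm_module G \<Omega> act :: ('k::field, 'x \<Rightarrow> 'k, 'g) kG_module)"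
proof (rule kG_moduleI)
  let ?M = "perm_module G \<Omega> act :: ('k, 'x \<Rightarrow> 'k, 'g) kG_module"
  show "group G" ..
  show "p \<oplus>\<^bsub>?M\<^esub> q \<in> carrier ?M" if "p \<in> carrier ?M" "q \<in> carrier ?M" for p q
  proof -
    have "{x. p x + q x \<noteq> 0} \<subseteq> {x. p x \<noteq> 0} \<union> {x. q x \<noteq> 0}" by auto
    then show ?thesis
      using that by (auto simp: perm_module_carrier intro: finite_subset)
  qed
  show "p \<star>\<^bsub>?M\<^esub> g \<in> carrier ?M" if "p \<in> carrier ?M" "g \<in> carrier G" for p g
    unfolding perm_module_carrier gact_support[OF that]
    using that by (auto simp: perm_module_carrier act_closed)
  show "p \<star>\<^bsub>?M\<^esub> \<one> = p" if "p \<in> carrier ?M" for p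
    using that by (auto simp: perm_module_gact perm_module_carrier act_one fun_eq_iff)
  show "p \<star>\<^bsub>?M\<^esub> (g \<otimes> h) = p \<star>\<^bsub>?M\<^esub> g \<star>\<^bsub>?M\<^esub> h"
    if "p \<in> carrier ?M" "g \<in> carrier G" "h \<in> carrier G" for p g h
    using that by (auto simp: perm_module_gact act_closed inv_mult_group act_mult)
qed (auto simp: perm_module_carrier perm_module_gact algebra_simps)

text \<open>
  Translating a vector amounts to translating the functional.  Hence the common kernel of a family of
  functionals that is closed under translation is \<open>G\<close>-stable.
\<close>

lemma lin_ext_gact:
  fixes p :: "'x \<Rightarrow> 'k::field"
  assumes p: "p \<in> carrier (perm_module G \<Omega> act)" and g: "g \<in> carrier G"
  shows "lin_ext \<phi> (p \<star>\<^bsub>perm_module G \<Omega> act\<^esub> g) = lin_ext (\<lambda>x. \<phi> (act x g)) p"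
proof -
  have sub: "{x. p x \<noteq> 0} \<subseteq> \<Omega>" using p by (simp add: perm_module_carrier)
  have inj: "inj_on (\<lambda>x. act x g) {x. p x \<noteq> 0}"
    by (rule inj_on_inverseI[of _ "\<lambda>x. act x (inv g)"]) (use sub g in auto)
  show ?thesis
    unfolding lin_ext_def gact_support[OF p g] sum.reindex[OF inj] comp_def
    by (rule sum.cong) (use sub g in \<open>auto simp: perm_module_gact act_closed\<close>)
qed

end

text \<open>
  The definition of \<open>finsum\<close> refers to the carrier of the module; the carrier is arbitrary here so that
  the rule also covers submodules of a permutation module.
\<close>

lemma finsum_perm_module:
  assumes "kG_module G ((perm_module G \<Omega> act)\<lparr>carrier := S\<rparr>)"
    and "finite I" "\<And>i. i \<in> I \<Longrightarrow> t i \<in> S"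
  shows "finsum ((perm_module G \<Omega> act)\<lparr>carrier := S\<rparr>) t I = (\<lambda>x. \<Sum>i\<in>I. t i x)"
proof -
  interpret kG_module G "(perm_module G \<Omega> act)\<lparr>carrier := S\<rparr>" by fact
  show ?thesis using assms(2,3)
  proof (induction I)
    case (insert i I)
    then show ?case by (subst M.finsum_insert) auto
  qed simp
qed

lemma kG_submodule_perm_sum_closed:
  fixes P :: "('x \<Rightarrow> 'k::field) set"
  assumes "kG_submodule P G (perm_module G \<Omega> act)"
    and "kG_module G (perm_module G \<Omega> act :: ('k, 'x \<Rightarrow> 'k, 'g) kG_module)"
    and "\<And>i. i \<in> I \<Longrightarrow> t i \<in> P"
  shows "(\<lambda>x. \<Sum>i\<in>I. a i * t i x) \<in> P"
proof -
  interpret kG_module G "perm_module G \<Omega> act :: ('k, 'x \<Rightarrow> 'k, 'g) kG_module" by fact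
  note D = kG_submoduleD[OF assms(1)]
  show ?thesis
  proof (cases "finite I")
    case True
    then show ?thesis using assms(3)
    proof (induction I)
      case (insert i I)
      then show ?case
        using D(3)[of "\<lambda>x. a i * t i x" "\<lambda>x. \<Sum>i\<in>I. a i * t i x"] D(4)[of "t i" "a i"] by simp
    qed (use D(2) in simp)
  qed (use D(2) in simp)
qed

lemma perm_module_expand:
  assumes "p \<in> carrier (perm_module G \<Omega> act)"
  shows "p = (\<lambda>z. \<Sum>x | p x \<noteq> 0. p x * basis_elem x z)"
proof
  fix z
  have "(\<Sum>x | p x \<noteq> 0. p x * basis_elem x z) = (\<Sum>x | p x \<noteq> 0. if z = x then p x else 0)"
    by (rule sum.cong) (auto simp: basis_elem_def)
  then show "p z = (\<Sum>x | p x \<noteq> 0. p x * basis_elem x z)"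
    using assms by (simp add: perm_module_carrier)
qed

lemma lin_ext_cong: "(\<And>x. p x \<noteq> 0 \<Longrightarrow> \<phi> x = \<psi> x) \<Longrightarrow> lin_ext \<phi> p = lin_ext \<psi> p"
  by (simp add: lin_ext_def)

lemma finite_support_basis_elem [simp]: "finite {x. basis_elem a x \<noteq> 0}"
  by (rule finite_subset[of _ "{a}"]) (auto simp: basis_elem_def)

lemma finite_support_smult:
  "finite {x. p x \<noteq> 0} \<Longrightarrow> finite {x. a * p x \<noteq> (0::'l::field)}"
  by (rule finite_subset[of _ "{x. p x \<noteq> 0}"]) auto

lemma finite_support_diff:
  "\<lbrakk>finite {x. p x \<noteq> 0}; finite {x. q x \<noteq> 0}\<rbrakk> \<Longrightarrow> finite {x. p x - q x \<noteq> (0::'l::field)}"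
  by (rule finite_subset[of _ "{x. p x \<noteq> 0} \<union> {x. q x \<noteq> 0}"]) auto

lemma finite_support_sum:
  assumes "finite I" "\<And>i. i \<in> I \<Longrightarrow> finite {x. t i x \<noteq> 0}"
  shows "finite {x. (\<Sum>i\<in>I. a i * t i x) \<noteq> (0::'l::field)}"
proof (rule finite_subset)
  show "{x. (\<Sum>i\<in>I. a i * t i x) \<noteq> 0} \<subseteq> (\<Union>i\<in>I. {x. t i x \<noteq> 0})"
    by (auto elim!: sum.not_neutral_contains_not_neutral)
qed (use assms in auto)

lemma lin_ext_sum:
  assumes "finite I" "\<And>i. i \<in> I \<Longrightarrow> finite {x. t i x \<noteq> 0}"
  shows "lin_ext \<phi> (\<lambda>x. \<Sum>i\<in>I. a i * t i x) = (\<Sum>i\<in>I. a i * lin_ext \<phi> (t i))"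
  using assms
proof (induction I)
  case (insert i I)
  then have "lin_ext \<phi> (\<lambda>x. a i * t i x + (\<Sum>i\<in>I. a i * t i x)) =
      lin_ext \<phi> (\<lambda>x. a i * t i x) + lin_ext \<phi> (\<lambda>x. \<Sum>i\<in>I. a i * t i x)"
    by (intro lin_ext_add finite_support_smult finite_support_sum) auto
  then show ?case using insert by (simp add: lin_ext_smult)
qed simp

section \<open>A criterion for absolute irreducibility\<close>

lemma (in kG_module) additive_finsum:
  fixes \<phi> :: "'m \<Rightarrow> 'a::comm_monoid_add"
  assumes "finite I" "\<And>i. i \<in> I \<Longrightarrow> t i \<in> carrier M" "\<phi> \<zero>\<^bsub>M\<^esub> = 0"
    and "\<And>x y. \<lbrakk>x \<in> carrier M; y \<in> carrier M\<rbrakk> \<Longrightarrow> \<phi> (x \<oplus>\<^bsub>M\<^esub> y) = \<phi> x + \<phi> y"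
  shows "\<phi> (finsum M t I) = (\<Sum>i\<in>I. \<phi> (t i))"
  using assms(1,2)
proof (induction I)
  case (insert i I)
  have "finsum M t I \<in> carrier M" using insert by (intro M.finsum_closed) auto
  then show ?case using insert assms(4) by (subst M.finsum_insert) auto
qed (simp add: assms(3))

text \<open>
  Here \<open>c\<close> describes the element \<open>\<kappa> = \<Sum>v\<in>V. c v * v\<close> of the group algebra.  It acts on \<open>M\<close> with image in the
  line through the generator \<open>e\<close>, and the submodule of all \<open>x\<close> that are annihilated by \<open>g\<kappa>\<close> for every
  \<open>g\<close> is zero.
\<close>

locale rank_one_kG_module = kG_module G M
  for G :: "('g, 'b) monoid_scheme" and M :: "('k::field, 'm, 'g) kG_module" +
  fixes V :: "'g set" and c :: "'g \<Rightarrow> 'k" and e :: 'm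
  assumes finite_G: "finite (carrier G)" and V_subset: "V \<subseteq> carrier G"
    and e_in: "e \<in> carrier M" and e_nonzero: "e \<noteq> \<zero>\<^bsub>M\<^esub>"
    and e_generates: "\<And>H. \<lbrakk>kG_submodule H G M; e \<in> H\<rbrakk> \<Longrightarrow> H = carrier M"
    and rank_one: "\<And>x. x \<in> carrier M \<Longrightarrow> \<exists>a. (\<Oplus>\<^bsub>M\<^esub>v\<in>V. c v \<odot>\<^bsub>M\<^esub> (x \<star>\<^bsub>M\<^esub> v)) = a \<odot>\<^bsub>M\<^esub> e"
    and nondegenerate: "\<And>x. \<lbrakk>x \<in> carrier M;
          \<And>g. g \<in> carrier G \<Longrightarrow> (\<Oplus>\<^bsub>M\<^esub>v\<in>V. c v \<odot>\<^bsub>M\<^esub> (x \<star>\<^bsub>M\<^esub> g \<star>\<^bsub>M\<^esub> v)) = \<zero>\<^bsub>M\<^esub>\<rbrakk> \<Longrightarrow> x = \<zero>\<^bsub>M\<^esub>"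
begin

definition kappa :: "'m \<Rightarrow> 'm" where "kappa x = (\<Oplus>\<^bsub>M\<^esub>v\<in>V. c v \<odot>\<^bsub>M\<^esub> (x \<star>\<^bsub>M\<^esub> v))"

text \<open>
  The coordinate of \<open>x\<kappa>\<close> with respect to \<open>e\<close>, which is unique because \<open>e\<close> is nonzero.
\<close>

definition coord :: "'m \<Rightarrow> 'k" where "coord x = (THE a. kappa x = a \<odot>\<^bsub>M\<^esub> e)"

lemma finite_V: "finite V" using V_subset finite_G finite_subset by blast

lemma V_in: "v \<in> V \<Longrightarrow> v \<in> carrier G" using V_subset by auto

lemma smult_e_inj: "a \<odot>\<^bsub>M\<^esub> e = b \<odot>\<^bsub>M\<^esub> e \<Longrightarrow> a = b"
proof -
  assume *: "a \<odot>\<^bsub>M\<^esub> e = b \<odot>\<^bsub>M\<^esub> e"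
  have "(a - b) \<odot>\<^bsub>M\<^esub> e = (a + -1 * b) \<odot>\<^bsub>M\<^esub> e" by simp
  also have "\<dots> = a \<odot>\<^bsub>M\<^esub> e \<oplus>\<^bsub>M\<^esub> (-1) \<odot>\<^bsub>M\<^esub> (a \<odot>\<^bsub>M\<^esub> e)"
    using e_in * by (simp only: smult_add_left smult_smult[symmetric])
  also have "\<dots> = \<zero>\<^bsub>M\<^esub>" using e_in by (simp add: M.r_neg flip: minus_eq_smult)
  finally show "a = b" using smult_eq_zero_iff[OF e_in] e_nonzero by auto
qed

lemma kappa_eq: assumes "x \<in> carrier M" shows "kappa x = coord x \<odot>\<^bsub>M\<^esub> e"
proof -
  obtain a where a: "kappa x = a \<odot>\<^bsub>M\<^esub> e" using rank_one[OF assms] by (auto simp: kappa_def)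
  then have "coord x = a" unfolding coord_def by (rule the_equality) (metis a smult_e_inj)
  then show ?thesis using a by simp
qed

lemma kappa_add:
  "\<lbrakk>x \<in> carrier M; y \<in> carrier M\<rbrakk> \<Longrightarrow> kappa (x \<oplus>\<^bsub>M\<^esub> y) = kappa x \<oplus>\<^bsub>M\<^esub> kappa y"
proof -
  assume xy: "x \<in> carrier M" "y \<in> carrier M"
  have "kappa (x \<oplus>\<^bsub>M\<^esub> y) = (\<Oplus>\<^bsub>M\<^esub>v\<in>V. c v \<odot>\<^bsub>M\<^esub> (x \<star>\<^bsub>M\<^esub> v) \<oplus>\<^bsub>M\<^esub> c v \<odot>\<^bsub>M\<^esub> (y \<star>\<^bsub>M\<^esub> v))"
    unfolding kappa_def
    by (rule M.finsum_cong') (use xy in \<open>auto simp: V_in gact_closed gact_add smult_add_right\<close>)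
  also have "\<dots> = kappa x \<oplus>\<^bsub>M\<^esub> kappa y"
    unfolding kappa_def by (rule M.finsum_addf) (use xy in \<open>auto simp: V_in gact_closed\<close>)
  finally show ?thesis .
qed

lemma kappa_smult: "x \<in> carrier M \<Longrightarrow> kappa (a \<odot>\<^bsub>M\<^esub> x) = a \<odot>\<^bsub>M\<^esub> kappa x"
  unfolding kappa_def
  by (subst M.finsum_smult_ldistr)
     (auto intro!: M.finsum_cong' simp: finite_V V_in gact_closed gact_smult smult_smult mult.commute)

lemma coord_add: "\<lbrakk>x \<in> carrier M; y \<in> carrier M\<rbrakk> \<Longrightarrow> coord (x \<oplus>\<^bsub>M\<^esub> y) = coord x + coord y"
  using kappa_add[of x y] by (intro smult_e_inj) (simp add: kappa_eq smult_add_left e_in)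

lemma coord_smult: "x \<in> carrier M \<Longrightarrow> coord (a \<odot>\<^bsub>M\<^esub> x) = a * coord x"
  using kappa_smult[of x a] by (intro smult_e_inj) (simp add: kappa_eq smult_smult e_in)

lemma coord_zero: "coord \<zero>\<^bsub>M\<^esub> = 0"
  using coord_smult[of "\<zero>\<^bsub>M\<^esub>" 0] by simp

lemma gact_zero: "g \<in> carrier G \<Longrightarrow> \<zero>\<^bsub>M\<^esub> \<star>\<^bsub>M\<^esub> g = \<zero>\<^bsub>M\<^esub>"
  using gact_smult[of "\<zero>\<^bsub>M\<^esub>" g 0] by (simp add: gact_closed)

lemma coord_gact_finsum:
  assumes "g \<in> carrier G" "finite I" "\<And>i. i \<in> I \<Longrightarrow> t i \<in> carrier M"
  shows "coord (finsum M t I \<star>\<^bsub>M\<^esub> g) = (\<Sum>i\<in>I. coord (t i \<star>\<^bsub>M\<^esub> g))"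
  by (rule additive_finsum[where \<phi> = "\<lambda>x. coord (x \<star>\<^bsub>M\<^esub> g)"])
     (use assms in \<open>auto simp: gact_zero coord_zero gact_add gact_closed coord_add\<close>)

text \<open>
  Apply the functional \<open>y \<mapsto> coord (yh)\<close> to both sides of \<open>x\<kappa> = coord x * e\<close>.  The result is an identity
  between scalars, which an embedding of fields preserves.
\<close>

lemma coord_kappa_gact:
  assumes "x \<in> carrier M" "h \<in> carrier G"
  shows "(\<Sum>v\<in>V. c v * coord (x \<star>\<^bsub>M\<^esub> v \<star>\<^bsub>M\<^esub> h)) = coord x * coord (e \<star>\<^bsub>M\<^esub> h)"
proof -
  have "(\<Sum>v\<in>V. c v * coord (x \<star>\<^bsub>M\<^esub> v \<star>\<^bsub>M\<^esub> h)) = (\<Sum>v\<in>V. coord ((c v \<odot>\<^bsub>M\<^esub> (x \<star>\<^bsub>M\<^esub> v)) \<star>\<^bsub>M\<^esub> h))"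
    by (rule sum.cong) (use assms in \<open>auto simp: gact_smult gact_closed V_in coord_smult\<close>)
  also have "\<dots> = coord (kappa x \<star>\<^bsub>M\<^esub> h)"
    unfolding kappa_def using assms
    by (subst coord_gact_finsum) (auto simp: finite_V gact_closed V_in)
  also have "\<dots> = coord x * coord (e \<star>\<^bsub>M\<^esub> h)"
    using assms e_in by (simp add: kappa_eq gact_smult gact_closed coord_smult)
  finally show ?thesis .
qed

text \<open>
  This is the form in which nondegeneracy is used: it speaks of linear functionals, which can be
  extended to larger fields.
\<close>

lemma coord_separates:
  assumes "x \<in> carrier M" "\<And>g. g \<in> carrier G \<Longrightarrow> coord (x \<star>\<^bsub>M\<^esub> g) = 0" shows "x = \<zero>\<^bsub>M\<^esub>"
proof (rule nondegenerate)
  fix g assume g: "g \<in> carrier G"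
  have "kappa (x \<star>\<^bsub>M\<^esub> g) = \<zero>\<^bsub>M\<^esub>"
    using assms g e_in by (simp add: kappa_eq gact_closed)
  then show "(\<Oplus>\<^bsub>M\<^esub>v\<in>V. c v \<odot>\<^bsub>M\<^esub> (x \<star>\<^bsub>M\<^esub> g \<star>\<^bsub>M\<^esub> v)) = \<zero>\<^bsub>M\<^esub>" by (simp add: kappa_def)
qed fact

text \<open>
  If \<open>x\<close> lies in a submodule, so does \<open>xg\<kappa>\<close>, a multiple of \<open>e\<close>.  In a proper submodule all these
  multiples are zero, and then \<open>x\<close> is zero by nondegeneracy.
\<close>

lemma irreducible: "irreducible_kG_module G M"
  unfolding irreducible_kG_module_def
proof (intro conjI allI impI)
  show "kG_module G M" ..
  show "carrier M \<noteq> {\<zero>\<^bsub>M\<^esub>}" using e_in e_nonzero by auto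
  fix H assume H: "kG_submodule H G M"
  note D = kG_submoduleD[OF H]
  show "H = {\<zero>\<^bsub>M\<^esub>} \<or> H = carrier M"
  proof (rule disjCI)
    assume "H \<noteq> carrier M"
    then have "e \<notin> H" using e_generates[OF H] by auto
    have "x = \<zero>\<^bsub>M\<^esub>" if "x \<in> H" for x
    proof (rule coord_separates)
      show "x \<in> carrier M" using that D(1) by auto
      fix g assume g: "g \<in> carrier G"
      have xg: "x \<star>\<^bsub>M\<^esub> g \<in> H" using D(5) that g by auto
      then have "kappa (x \<star>\<^bsub>M\<^esub> g) \<in> H"
        unfolding kappa_def by (intro finsum_in_kG_submodule[OF H] D(4) D(5)[OF xg]) (simp add: V_in)
      then have in_H: "coord (x \<star>\<^bsub>M\<^esub> g) \<odot>\<^bsub>M\<^esub> e \<in> H" using xg D(1) by (simp add: kappa_eq subset_iff)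
      show "coord (x \<star>\<^bsub>M\<^esub> g) = 0"
      proof (rule ccontr)
        assume "coord (x \<star>\<^bsub>M\<^esub> g) \<noteq> 0"
        moreover have "inverse (coord (x \<star>\<^bsub>M\<^esub> g)) \<odot>\<^bsub>M\<^esub> (coord (x \<star>\<^bsub>M\<^esub> g) \<odot>\<^bsub>M\<^esub> e) \<in> H"
          by (rule D(4)[OF in_H])
        ultimately have "e \<in> H" using e_in by (simp add: smult_smult)
        then show False using \<open>e \<notin> H\<close> by simp
      qed
    qed
    then show "H = {\<zero>\<^bsub>M\<^esub>}" using D(2) by blast
  qed
qed

text \<open>
  Choose a set \<open>B\<close> of group elements that is minimal among those for which the functionals
  \<open>x \<mapsto> coord (xb)\<close> separate the points of \<open>M\<close>.  By minimality, for each \<open>b\<close> some nonzero vector is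
  annihilated by all the other functionals, and a multiple of it is the dual basis vector \<open>w b\<close>.
\<close>

lemma dual_basis:
  obtains B w where "B \<subseteq> carrier G" and "\<And>b. b \<in> B \<Longrightarrow> w b \<in> carrier M"
    and "\<And>x. x \<in> carrier M \<Longrightarrow> x = (\<Oplus>\<^bsub>M\<^esub>b\<in>B. coord (x \<star>\<^bsub>M\<^esub> b) \<odot>\<^bsub>M\<^esub> w b)"
proof -
  define sep where "sep B \<longleftrightarrow> B \<subseteq> carrier G \<and>
    (\<forall>x\<in>carrier M. (\<forall>b\<in>B. coord (x \<star>\<^bsub>M\<^esub> b) = 0) \<longrightarrow> x = \<zero>\<^bsub>M\<^esub>)" for B
  have "sep (carrier G)" unfolding sep_def using coord_separates by auto
  then obtain B where B: "sep B" and min: "\<And>B'. sep B' \<Longrightarrow> card B \<le> card B'"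
    using ex_has_least_nat[of sep _ card] by metis
  have BG: "B \<subseteq> carrier G" using B by (simp add: sep_def)
  then have finB: "finite B" using finite_G finite_subset by blast
  have ex: "\<exists>w\<in>carrier M. \<forall>b'\<in>B. coord (w \<star>\<^bsub>M\<^esub> b') = (if b' = b then 1 else 0)" if b: "b \<in> B" for b
  proof -
    have "\<not> sep (B - {b})"
      using min[of "B - {b}"] card_Diff1_less[OF finB b] by auto
    then obtain x where x: "x \<in> carrier M" "x \<noteq> \<zero>\<^bsub>M\<^esub>" "\<And>b'. b' \<in> B - {b} \<Longrightarrow> coord (x \<star>\<^bsub>M\<^esub> b') = 0"
      unfolding sep_def using BG by auto
    then have "coord (x \<star>\<^bsub>M\<^esub> b) \<noteq> 0" using B unfolding sep_def by blast
    then show ?thesis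
      using x BG b
      by (intro bexI[of _ "inverse (coord (x \<star>\<^bsub>M\<^esub> b)) \<odot>\<^bsub>M\<^esub> x"])
         (auto simp: gact_smult gact_closed coord_smult subset_iff)
  qed
  then obtain w where w: "\<And>b. b \<in> B \<Longrightarrow> w b \<in> carrier M"
    "\<And>b b'. \<lbrakk>b \<in> B; b' \<in> B\<rbrakk> \<Longrightarrow> coord (w b \<star>\<^bsub>M\<^esub> b') = (if b' = b then 1 else 0)"
    by metis
  show ?thesis
  proof (rule that[OF BG w(1)])
    fix x assume x: "x \<in> carrier M"
    define y where "y = (\<Oplus>\<^bsub>M\<^esub>b\<in>B. coord (x \<star>\<^bsub>M\<^esub> b) \<odot>\<^bsub>M\<^esub> w b)"
    have y: "y \<in> carrier M" unfolding y_def using w by (intro M.finsum_closed) auto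
    have "coord ((x \<ominus>\<^bsub>M\<^esub> y) \<star>\<^bsub>M\<^esub> b') = 0" if b': "b' \<in> B" for b'
    proof -
      have [simp]: "b' \<in> carrier G" using BG b' by auto
      have "coord (y \<star>\<^bsub>M\<^esub> b') = (\<Sum>b\<in>B. coord ((coord (x \<star>\<^bsub>M\<^esub> b) \<odot>\<^bsub>M\<^esub> w b) \<star>\<^bsub>M\<^esub> b'))"
        unfolding y_def using w by (intro coord_gact_finsum) (auto simp: finB)
      also have "\<dots> = (\<Sum>b\<in>B. if b' = b then coord (x \<star>\<^bsub>M\<^esub> b) else 0)"
        by (rule sum.cong) (use w b' in \<open>auto simp: gact_smult coord_smult gact_closed\<close>)
      also have "\<dots> = coord (x \<star>\<^bsub>M\<^esub> b')" using finB b' by simp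
      finally show ?thesis
        using x y by (simp add: a_minus_def minus_eq_smult gact_add gact_smult gact_closed coord_add coord_smult)
    qed
    then have "x \<ominus>\<^bsub>M\<^esub> y = \<zero>\<^bsub>M\<^esub>" using B x y unfolding sep_def by auto
    then have "x = y"
      using M.minus_equality[of x "\<ominus>\<^bsub>M\<^esub> y"] x y by (simp add: a_minus_def)
    then show "x = (\<Oplus>\<^bsub>M\<^esub>b\<in>B. coord (x \<star>\<^bsub>M\<^esub> b) \<odot>\<^bsub>M\<^esub> w b)" by (simp add: y_def)
  qed
qed

end

section \<open>Extension of scalars\<close>

context rank_one_kG_module
begin

text \<open>
  Extension of scalars is the free module \<open>F\<close> on the set \<open>M\<close> modulo the span \<open>R\<close> of the relations.  The key
  step is to recognise \<open>R\<close> as the common kernel \<open>K\<close> of the linear extensions \<open>\<Lambda> g\<close> of the functionals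
  \<open>x \<mapsto> coord (xg)\<close>.  After that the argument of lemma \<open>irreducible\<close> applies to the submodules of \<open>F\<close> above \<open>R\<close>.
\<close>

lemma irreducible_extend_scalars:
  fixes \<iota> :: "'k \<Rightarrow> 'l::field"
  assumes \<iota>_add: "\<And>a b. \<iota> (a + b) = \<iota> a + \<iota> b" and \<iota>_mult: "\<And>a b. \<iota> (a * b) = \<iota> a * \<iota> b"
    and \<iota>_one: "\<iota> 1 = 1"
  shows "irreducible_kG_module G (extend_scalars \<iota> G M)"
proof -
  interpret A: right_action G "carrier M" "gact M"
    by unfold_locales (auto simp: gact_closed gact_one gact_mult)
  let ?F = "perm_module G (carrier M) (gact M) :: ('l, 'm \<Rightarrow> 'l, 'g) kG_module"
  interpret F: kG_module G ?F by (rule A.kG_module_perm)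
  have F_finite: "finite {x. p x \<noteq> 0}" if "p \<in> carrier ?F" for p
    using that by (simp add: perm_module_carrier)
  have F_supp: "x \<in> carrier M" if "p \<in> carrier ?F" "p x \<noteq> 0" for p x
    using that by (auto simp: perm_module_carrier)

  have \<iota>_zero: "\<iota> 0 = 0" using \<iota>_add[of 0 0] by (metis add_0 add_cancel_right_right)
  have \<iota>_nonzero: "\<iota> a \<noteq> 0" if "a \<noteq> 0" for a
    using \<iota>_mult[of a "inverse a"] that \<iota>_one by auto
  have \<iota>_sum: "\<iota> (sum t I) = (\<Sum>i\<in>I. \<iota> (t i))" for t :: "'g \<Rightarrow> 'k" and I
    by (induction I rule: infinite_finite_induct) (auto simp: \<iota>_zero \<iota>_add)

  define \<Lambda> where "\<Lambda> g = lin_ext (\<lambda>x. \<iota> (coord (x \<star>\<^bsub>M\<^esub> g)))" for g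
  have \<Lambda>_gact: "\<Lambda> h (p \<star>\<^bsub>?F\<^esub> g) = \<Lambda> (g \<otimes>\<^bsub>G\<^esub> h) p"
    if "p \<in> carrier ?F" "g \<in> carrier G" "h \<in> carrier G" for p g h
    unfolding \<Lambda>_def A.lin_ext_gact[OF that(1,2)]
    by (rule lin_ext_cong) (use that F_supp in \<open>auto simp: gact_mult\<close>)
  define K where "K = {p \<in> carrier ?F. \<forall>g\<in>carrier G. \<Lambda> g p = 0}"
  have K_sub: "kG_submodule K G ?F"
  proof (rule F.kG_submoduleI)
    show "p \<star>\<^bsub>?F\<^esub> g \<in> K" if "p \<in> K" "g \<in> carrier G" for p g
      using that by (auto simp: K_def \<Lambda>_gact F.gact_closed)
    show "p \<oplus>\<^bsub>?F\<^esub> q \<in> K" if "p \<in> K" "q \<in> K" for p q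
      using that F.M.add.m_closed[of p q]
      by (simp add: K_def \<Lambda>_def lin_ext_add F_finite)
    show "a \<odot>\<^bsub>?F\<^esub> p \<in> K" if "p \<in> K" for a p
      using that F.smult_in[of p a] by (simp add: K_def \<Lambda>_def lin_ext_smult)
  qed (use F.M.zero_closed in \<open>auto simp: K_def \<Lambda>_def\<close>)

  have rel_in: "tensor_relations \<iota> M \<subseteq> carrier ?F"
  proof
    fix r assume "r \<in> tensor_relations \<iota> M"
    then consider (add) x y where "x \<in> carrier M" "y \<in> carrier M"
        "r = (\<lambda>z. basis_elem (x \<oplus>\<^bsub>M\<^esub> y) z - basis_elem x z - basis_elem y z)"
      | (smult) a x where "x \<in> carrier M"
        "r = (\<lambda>z. basis_elem (a \<odot>\<^bsub>M\<^esub> x) z - \<iota> a * basis_elem x z)"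
      unfolding tensor_relations_def by blast
    then show "r \<in> carrier ?F"
    proof cases
      case add
      have "{z. r z \<noteq> 0} \<subseteq> {x \<oplus>\<^bsub>M\<^esub> y, x, y}" by (auto simp: add basis_elem_def)
      then show ?thesis using add by (auto simp: perm_module_carrier intro: finite_subset)
    next
      case smult
      have "{z. r z \<noteq> 0} \<subseteq> {a \<odot>\<^bsub>M\<^esub> x, x}" by (auto simp: smult basis_elem_def)
      then show ?thesis using smult by (auto simp: perm_module_carrier intro: finite_subset)
    qed
  qed
  define R where "R = kG_span G ?F (tensor_relations \<iota> M)"
  have R_sub: "kG_submodule R G ?F" unfolding R_def by (rule F.kG_submodule_span) (rule rel_in)
  note R = F.kG_submoduleD[OF R_sub, unfolded perm_module_sels]
  have "tensor_relations \<iota> M \<subseteq> R" unfolding R_def by (rule subset_kG_span)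
  note rels_R = subsetD[OF this, unfolded tensor_relations_def]
  have rel_add: "(\<lambda>z. basis_elem (x \<oplus>\<^bsub>M\<^esub> y) z - basis_elem x z - basis_elem y z) \<in> R"
    if "x \<in> carrier M" "y \<in> carrier M" for x y
    by (rule rels_R) (use that in blast)
  have rel_smult: "(\<lambda>z. basis_elem (a \<odot>\<^bsub>M\<^esub> x) z - \<iota> a * basis_elem x z) \<in> R"
    if "x \<in> carrier M" for a x
    by (rule rels_R) (use that in blast)
  have rel_zero: "basis_elem \<zero>\<^bsub>M\<^esub> \<in> R"
    using R(4)[OF rel_add[of "\<zero>\<^bsub>M\<^esub>" "\<zero>\<^bsub>M\<^esub>"], of "-1"] by simp

  have "tensor_relations \<iota> M \<subseteq> K"
  proof
    fix r assume r: "r \<in> tensor_relations \<iota> M"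
    then consider (add) x y where "x \<in> carrier M" "y \<in> carrier M"
        "r = (\<lambda>z. basis_elem (x \<oplus>\<^bsub>M\<^esub> y) z - basis_elem x z - basis_elem y z)"
      | (smult) a x where "x \<in> carrier M"
        "r = (\<lambda>z. basis_elem (a \<odot>\<^bsub>M\<^esub> x) z - \<iota> a * basis_elem x z)"
      unfolding tensor_relations_def by blast
    then have "\<Lambda> g r = 0" if "g \<in> carrier G" for g
    proof cases
      case add
      then show ?thesis using that
        by (simp add: \<Lambda>_def lin_ext_diff lin_ext_diff[OF finite_support_diff] gact_add gact_closed coord_add \<iota>_add)
    next
      case smult
      then show ?thesis using that
        by (simp add: \<Lambda>_def lin_ext_diff finite_support_smult lin_ext_smult gact_smult gact_closed
            coord_smult \<iota>_mult)
    qed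
    then show "r \<in> K" using r rel_in by (auto simp: K_def)
  qed
  then have "R \<subseteq> K" unfolding R_def by (intro kG_span_subset K_sub)
  \<comment> \<open>Modulo \<open>R\<close>, every basis vector \<open>x\<close> is the combination of the \<open>w b\<close> with coefficients \<open>\<iota> (coord (xb))\<close>,
      so every \<open>p\<close> is the combination of the \<open>w b\<close> with coefficients \<open>\<Lambda> b p\<close>, which vanish for \<open>p\<close> in \<open>K\<close>.\<close>
  have "K \<subseteq> R"
  proof
    fix p assume p: "p \<in> K"
    obtain B w where B: "B \<subseteq> carrier G" and w: "\<And>b. b \<in> B \<Longrightarrow> w b \<in> carrier M"
      and dual: "\<And>x. x \<in> carrier M \<Longrightarrow> x = (\<Oplus>\<^bsub>M\<^esub>b\<in>B. coord (x \<star>\<^bsub>M\<^esub> b) \<odot>\<^bsub>M\<^esub> w b)"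
      by (rule dual_basis) blast
    have rel_finsum: "(\<lambda>z. basis_elem (\<Oplus>\<^bsub>M\<^esub>b\<in>B'. a b \<odot>\<^bsub>M\<^esub> w b) z - (\<Sum>b\<in>B'. \<iota> (a b) * basis_elem (w b) z)) \<in> R"
      if "finite B'" "B' \<subseteq> B" for a :: "'g \<Rightarrow> 'k" and B'
      using that
    proof (induction B')
      case empty
      then show ?case using rel_zero by simp
    next
      case (insert b B')
      define s where "s = (\<Oplus>\<^bsub>M\<^esub>b\<in>B'. a b \<odot>\<^bsub>M\<^esub> w b)"
      have s: "s \<in> carrier M" unfolding s_def using insert w by (intro M.finsum_closed) auto
      have wb: "w b \<in> carrier M" using insert w by auto
      have eq: "(\<Oplus>\<^bsub>M\<^esub>b\<in>insert b B'. a b \<odot>\<^bsub>M\<^esub> w b) = a b \<odot>\<^bsub>M\<^esub> w b \<oplus>\<^bsub>M\<^esub> s"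
        unfolding s_def using insert w by (intro M.finsum_insert) auto
      have IH: "(\<lambda>z. basis_elem s z - (\<Sum>b\<in>B'. \<iota> (a b) * basis_elem (w b) z)) \<in> R"
        unfolding s_def using insert by auto
      have "(\<lambda>z. (basis_elem (a b \<odot>\<^bsub>M\<^esub> w b \<oplus>\<^bsub>M\<^esub> s) z - basis_elem (a b \<odot>\<^bsub>M\<^esub> w b) z - basis_elem s z)
          + ((basis_elem (a b \<odot>\<^bsub>M\<^esub> w b) z - \<iota> (a b) * basis_elem (w b) z)
          + (basis_elem s z - (\<Sum>b\<in>B'. \<iota> (a b) * basis_elem (w b) z)))) \<in> R"
        by (rule R(3)[OF rel_add R(3)[OF rel_smult IH]]) (use s wb in auto)
      then show ?case
        using insert.hyps unfolding eq by (simp add: algebra_simps)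
    qed
    have finB: "finite B" using B finite_G finite_subset by blast
    define u where "u x = (\<lambda>z. basis_elem x z - (\<Sum>b\<in>B. \<iota> (coord (x \<star>\<^bsub>M\<^esub> b)) * basis_elem (w b) z))" for x
    have u: "u x \<in> R" if "x \<in> carrier M" for x
      using rel_finsum[OF finB subset_refl, of "\<lambda>b. coord (x \<star>\<^bsub>M\<^esub> b)"] dual[OF that] by (simp add: u_def)
    have pF: "p \<in> carrier ?F" using p by (simp add: K_def)
    have "(\<Sum>x | p x \<noteq> 0. p x * u x z) = p z" for z
    proof -
      have "(\<Sum>x | p x \<noteq> 0. p x * u x z) = (\<Sum>x | p x \<noteq> 0. p x * basis_elem x z) -
          (\<Sum>x | p x \<noteq> 0. \<Sum>b\<in>B. p x * \<iota> (coord (x \<star>\<^bsub>M\<^esub> b)) * basis_elem (w b) z)"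
        by (simp add: u_def right_diff_distrib sum_subtractf sum_distrib_left mult.assoc)
      also have "(\<Sum>x | p x \<noteq> 0. \<Sum>b\<in>B. p x * \<iota> (coord (x \<star>\<^bsub>M\<^esub> b)) * basis_elem (w b) z) =
          (\<Sum>b\<in>B. \<Lambda> b p * basis_elem (w b) z)"
        by (subst sum.swap) (simp add: \<Lambda>_def lin_ext_def sum_distrib_right)
      also have "\<dots> = 0" using p B by (intro sum.neutral) (auto simp: K_def)
      finally show ?thesis using fun_cong[OF perm_module_expand[OF pF], of z] by simp
    qed
    moreover have "(\<lambda>z. \<Sum>x | p x \<noteq> 0. p x * u x z) \<in> R"
      using u F_supp[OF pF] by (intro kG_submodule_perm_sum_closed[OF R_sub F.kG_module_axioms]) auto
    ultimately show "p \<in> R" by simp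
  qed
  with \<open>R \<subseteq> K\<close> have RK: "R = K" by auto

  have "irreducible_kG_module G (kG_quotient ?F R)"
  proof (rule F.irreducible_quotientI[OF R_sub])
    obtain g where "g \<in> carrier G" "coord (e \<star>\<^bsub>M\<^esub> g) \<noteq> 0"
      using coord_separates[OF e_in] e_nonzero by auto
    then have "basis_elem e \<notin> R" unfolding RK using \<iota>_nonzero by (auto simp: K_def \<Lambda>_def)
    then show "R \<noteq> carrier ?F" using e_in basis_elem_in_carrier by metis
  next
    fix P assume P_sub: "kG_submodule P G ?F" and "R \<subseteq> P" "P \<noteq> R"
    note P = F.kG_submoduleD[OF P_sub, unfolded perm_module_sels]
    obtain p g where p: "p \<in> P" "p \<in> carrier ?F" and g: "g \<in> carrier G" and nz: "\<Lambda> g p \<noteq> 0"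
      using \<open>R \<subseteq> P\<close> \<open>P \<noteq> R\<close> P(1) unfolding RK K_def by blast
    \<comment> \<open>The vector \<open>pg\<kappa>\<close> of \<open>F\<close>; it is congruent to \<open>\<Lambda> g p * e\<close> modulo \<open>R\<close>.\<close>
    define q where "q = (\<lambda>z. \<Sum>v\<in>V. \<iota> (c v) * (p \<star>\<^bsub>?F\<^esub> (g \<otimes>\<^bsub>G\<^esub> v)) z)"
    have q: "q \<in> P" unfolding q_def
      by (rule kG_submodule_perm_sum_closed[OF P_sub F.kG_module_axioms]) (use p P(5) g V_in in auto)
    have \<Lambda>q: "\<Lambda> h q = \<Lambda> g p * \<iota> (coord (e \<star>\<^bsub>M\<^esub> h))" if h: "h \<in> carrier G" for h
    proof -
      have "\<Lambda> h q = (\<Sum>v\<in>V. \<iota> (c v) * \<Lambda> h (p \<star>\<^bsub>?F\<^esub> (g \<otimes>\<^bsub>G\<^esub> v)))"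
        unfolding q_def \<Lambda>_def
        by (rule lin_ext_sum) (use finite_V V_in p g in \<open>auto intro!: F_finite F.gact_closed\<close>)
      also have "\<dots> = (\<Sum>v\<in>V. \<iota> (c v) * \<Lambda> (g \<otimes>\<^bsub>G\<^esub> v \<otimes>\<^bsub>G\<^esub> h) p)"
        using p g h V_in by (intro sum.cong) (auto simp: \<Lambda>_gact)
      also have "\<dots> = lin_ext (\<lambda>x. \<Sum>v\<in>V. \<iota> (c v) * \<iota> (coord (x \<star>\<^bsub>M\<^esub> (g \<otimes>\<^bsub>G\<^esub> v \<otimes>\<^bsub>G\<^esub> h)))) p"
        unfolding \<Lambda>_def by (rule lin_ext_fun_sum[symmetric])
      also have "\<dots> = lin_ext (\<lambda>x. \<iota> (coord (e \<star>\<^bsub>M\<^esub> h)) * \<iota> (coord (x \<star>\<^bsub>M\<^esub> g))) p"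
      proof (rule lin_ext_cong)
        fix x assume "p x \<noteq> 0"
        then have x: "x \<in> carrier M" using F_supp p by auto
        have "(\<Sum>v\<in>V. \<iota> (c v) * \<iota> (coord (x \<star>\<^bsub>M\<^esub> (g \<otimes>\<^bsub>G\<^esub> v \<otimes>\<^bsub>G\<^esub> h)))) =
            \<iota> (\<Sum>v\<in>V. c v * coord (x \<star>\<^bsub>M\<^esub> g \<star>\<^bsub>M\<^esub> v \<star>\<^bsub>M\<^esub> h))"
          unfolding \<iota>_sum \<iota>_mult using x g h V_in
          by (intro sum.cong) (auto simp: gact_mult gact_closed)
        then show "(\<Sum>v\<in>V. \<iota> (c v) * \<iota> (coord (x \<star>\<^bsub>M\<^esub> (g \<otimes>\<^bsub>G\<^esub> v \<otimes>\<^bsub>G\<^esub> h)))) =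
            \<iota> (coord (e \<star>\<^bsub>M\<^esub> h)) * \<iota> (coord (x \<star>\<^bsub>M\<^esub> g))"
          using x g h by (simp add: coord_kappa_gact gact_closed \<iota>_mult mult.commute)
      qed
      also have "\<dots> = \<Lambda> g p * \<iota> (coord (e \<star>\<^bsub>M\<^esub> h))"
        unfolding \<Lambda>_def lin_ext_fun_smult by (rule mult.commute)
      finally show ?thesis .
    qed
    define d where "d = (\<lambda>z. q z - \<Lambda> g p * basis_elem e z)"
    have "basis_elem e \<in> carrier ?F" using e_in by simp
    moreover have qF: "q \<in> carrier ?F" using q P(1) by auto
    ultimately have "d \<in> carrier ?F"
      using F.M.add.m_closed[of q "(-\<Lambda> g p) \<odot>\<^bsub>?F\<^esub> basis_elem e"] F.smult_in[of "basis_elem e" "-\<Lambda> g p"]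
      by (simp add: d_def)
    moreover have "\<Lambda> h d = 0" if "h \<in> carrier G" for h
      using \<Lambda>q[OF that] F_finite[OF qF]
      by (simp add: d_def \<Lambda>_def lin_ext_diff finite_support_smult lin_ext_smult)
    ultimately have "d \<in> P" using \<open>R \<subseteq> P\<close> by (auto simp: RK K_def)
    then have "(\<lambda>z. inverse (\<Lambda> g p) * (q z + (-1) * d z)) \<in> P"
      using P(3,4) q by blast
    then have e_P: "basis_elem e \<in> P" using nz by (simp add: d_def flip: mult.assoc)
    \<comment> \<open>The vectors \<open>x\<close> of \<open>M\<close> with \<open>1 \<otimes> x\<close> in the image of \<open>P\<close>.\<close>
    define H where "H = {x \<in> carrier M. basis_elem x \<in> P}"
    have "kG_submodule H G M"
    proof (rule kG_submoduleI)
      show "\<zero>\<^bsub>M\<^esub> \<in> H" using rel_zero \<open>R \<subseteq> P\<close> by (auto simp: H_def)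
      show "x \<oplus>\<^bsub>M\<^esub> y \<in> H" if xy: "x \<in> H" "y \<in> H" for x y
      proof -
        have "(\<lambda>z. (basis_elem (x \<oplus>\<^bsub>M\<^esub> y) z - basis_elem x z - basis_elem y z) + (basis_elem x z + basis_elem y z)) \<in> P"
          by (intro P(3) subsetD[OF \<open>R \<subseteq> P\<close> rel_add]) (use xy in \<open>auto simp: H_def\<close>)
        then show ?thesis using xy by (simp add: H_def)
      qed
      show "a \<odot>\<^bsub>M\<^esub> x \<in> H" if x: "x \<in> H" for a x
      proof -
        have "(\<lambda>z. (basis_elem (a \<odot>\<^bsub>M\<^esub> x) z - \<iota> a * basis_elem x z) + \<iota> a * basis_elem x z) \<in> P"
          by (intro P(3,4) subsetD[OF \<open>R \<subseteq> P\<close> rel_smult]) (use x in \<open>auto simp: H_def\<close>)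
        then show ?thesis using x by (simp add: H_def)
      qed
      show "x \<star>\<^bsub>M\<^esub> h \<in> H" if x: "x \<in> H" and h: "h \<in> carrier G" for x h
      proof -
        have "basis_elem x \<star>\<^bsub>?F\<^esub> h = (basis_elem (x \<star>\<^bsub>M\<^esub> h) :: 'm \<Rightarrow> 'l)"
          using x h by (auto simp: perm_module_gact basis_elem_def H_def fun_eq_iff gact_closed)
        then show ?thesis using P(5)[of "basis_elem x" h] x h by (simp add: H_def gact_closed)
      qed
    qed (auto simp: H_def)
    moreover have "e \<in> H" using e_P e_in by (simp add: H_def)
    ultimately have "H = carrier M" by (rule e_generates)
    then have basis: "basis_elem x \<in> P" if "x \<in> carrier M" for x using that H_def by blast
    show "P = carrier ?F"
    proof
      show "carrier ?F \<subseteq> P"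
      proof
        fix p assume p: "p \<in> carrier ?F"
        have "(\<lambda>z. \<Sum>x | p x \<noteq> 0. p x * basis_elem x z) \<in> P"
          by (rule kG_submodule_perm_sum_closed[OF P_sub F.kG_module_axioms])
             (use basis F_supp[OF p] in auto)
        then show "p \<in> P" using perm_module_expand[OF p] by simp
      qed
    qed (rule P(1))
  qed
  then show ?thesis by (simp add: extend_scalars_def Let_def R_def)
qed

theorem absolutely_irreducible: "absolutely_irreducible_kG_module G M"
  unfolding absolutely_irreducible_kG_module_def
  by (intro conjI irreducible irreducible_extend_scalars) auto

end

section \<open>Sums over the subgroups of a James triple\<close>

locale fitted_james_triple = group G for G :: "('g, 'b) monoid_scheme" (structure) +
  fixes U V N :: "'g set" and k :: nat and \<alpha> :: "'k::field \<Rightarrow> 'k" and f :: "'g \<Rightarrow> 'k"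
  assumes finite_G: "finite (carrier G)"
    and \<alpha>_iso: "\<alpha> \<in> ring_iso ring_of_type_algebra ring_of_type_algebra"
    and james: "james_triple G k U V N"
    and f_hom: "f \<in> hom (G\<lparr>carrier := V\<rparr>) roots_of_unity"
    and fits: "fits G \<alpha> V N f"
begin

lemma U_subgroup: "subgroup U G" and V_subgroup: "subgroup V G" and N_subgroup: "subgroup N G"
  using james by (auto simp: james_triple_def)

sublocale U: subgroup U G by (rule U_subgroup)
sublocale V: subgroup V G by (rule V_subgroup)
sublocale N: subgroup N G by (rule N_subgroup)

lemma N_normal: "N \<lhd> G\<lparr>carrier := V\<rparr>"
  using james by (auto simp: james_triple_def)

lemma N_subset_V: "N \<subseteq> V"
  using subgroup.subset[OF normal_imp_subgroup[OF N_normal]] by simp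

lemma finite_V: "finite V"
  using V.subset finite_G finite_subset by blast

lemma f_mult: "\<lbrakk>v \<in> V; w \<in> V\<rbrakk> \<Longrightarrow> f (v \<otimes> w) = f v * f w"
  using f_hom by (simp add: hom_def roots_of_unity_def)

lemma f_nonzero: "v \<in> V \<Longrightarrow> f v \<noteq> 0"
proof
  assume "v \<in> V" "f v = 0"
  have "f v \<in> carrier roots_of_unity" using f_hom \<open>v \<in> V\<close> by (auto simp: hom_def)
  then obtain n :: nat where "n > 0" "f v ^ n = 1" by (auto simp: roots_of_unity_def)
  then show False using \<open>f v = 0\<close> by (simp add: power_0_left)
qed

lemma f_one: "f \<one> = 1"
  using f_mult[of \<one> \<one>] f_nonzero[of \<one>] by simp

lemma f_inv: "v \<in> V \<Longrightarrow> f (inv v) = inverse (f v)"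
  using f_mult[of v "inv v"] f_nonzero[of v] by (simp add: f_one field_simps)

lemma f_N: "n \<in> N \<Longrightarrow> f n = 1"
  using fits by (auto simp: fits_def Let_def kernel_def roots_of_unity_def)

lemma f_lcoset: "\<lbrakk>w \<in> V; v \<in> w <# N\<rbrakk> \<Longrightarrow> f v = f w"
  using N_subset_V by (auto simp: l_coset_def f_mult f_N)

definition cosets_N :: "'g set set" where "cosets_N = (\<lambda>w. w <# N) ` V"

text \<open>
  The character of \<open>V/N\<close> induced by \<open>f\<close>; as \<open>f\<close> is constant on cosets of \<open>N\<close>, any representative will do.
\<close>

definition f_coset :: "'g set \<Rightarrow> 'k" where "f_coset A = f (SOME w. w \<in> A)"

lemma f_coset_eq: "w \<in> V \<Longrightarrow> f_coset (w <# N) = f w"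
proof -
  assume w: "w \<in> V"
  then have "w \<in> w <# N"
    by (auto simp: l_coset_def intro!: bexI[of _ \<one>])
  then have "(SOME v. v \<in> w <# N) \<in> w <# N" by (rule someI)
  then show ?thesis unfolding f_coset_def by (rule f_lcoset[OF w])
qed

lemma card_cosets_N: "card cosets_N = Coset.order (G\<lparr>carrier := V\<rparr> Mod N)"
proof -
  have "N #>\<^bsub>G\<lparr>carrier := V\<rparr>\<^esub> w = w <# N" if "w \<in> V" for w
    using normal.coset_eq[OF N_normal] that by (simp add: l_coset_def)
  then have "rcosets\<^bsub>G\<lparr>carrier := V\<rparr>\<^esub> N = cosets_N"
    by (auto simp: RCOSETS_def cosets_N_def)
  then show ?thesis by (simp add: Coset.order_def FactGroup_def)
qed

text \<open>
  Orthogonality of \<open>f\<close> to the trivial character.  If \<open>f a \<noteq> 1\<close> for some \<open>a\<close>, translation by \<open>a\<close> multiplies the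
  sum by \<open>f a\<close>.  If \<open>f\<close> is trivial on \<open>V\<close>, the sum is the index of \<open>N\<close>, and for a trivial \<open>f\<close> to fit the
  triple the characteristic must divide this index.
\<close>

lemma sum_f_coset: "(\<Sum>A\<in>cosets_N. f_coset A) = 0"
proof (cases "\<forall>v\<in>V. f v = 1")
  case True
  then have "kernel (G\<lparr>carrier := V\<rparr>) roots_of_unity f = V"
    by (auto simp: kernel_def roots_of_unity_def)
  then have "CHAR('k) dvd card cosets_N"
    using fits by (auto simp: fits_def Let_def card_cosets_N)
  then have "of_nat (card cosets_N) = (0 :: 'k)" by (simp add: of_nat_eq_0_iff_char_dvd)
  moreover have "(\<Sum>A\<in>cosets_N. f_coset A) = (\<Sum>A\<in>cosets_N. 1)"
    by (rule sum.cong) (use True in \<open>auto simp: cosets_N_def f_coset_eq\<close>)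
  ultimately show ?thesis by simp
next
  case False
  then obtain a where a: "a \<in> V" "f a \<noteq> 1" by auto
  have assoc: "b <# (w <# N) = (b \<otimes> w) <# N" if "b \<in> V" "w \<in> V" for b w
    using that by (simp add: lcos_m_assoc N.subset)
  have bij: "bij_betw (\<lambda>A. a <# A) cosets_N cosets_N"
    by (rule bij_betw_byWitness[where f' = "\<lambda>A. inv a <# A"])
       (use a in \<open>auto simp: cosets_N_def assoc inv_solve_left simp flip: m_assoc\<close>)
  have "(\<Sum>A\<in>cosets_N. f_coset A) = (\<Sum>A\<in>cosets_N. f_coset (a <# A))"
    by (rule sum.reindex_bij_betw[OF bij, symmetric])
  also have "\<dots> = (\<Sum>A\<in>cosets_N. f a * f_coset A)"
    by (rule sum.cong) (use a in \<open>auto simp: cosets_N_def assoc f_coset_eq f_mult\<close>)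
  also have "\<dots> = f a * (\<Sum>A\<in>cosets_N. f_coset A)" by (rule sum_distrib_left[symmetric])
  finally show ?thesis using a(2) by simp
qed

lemma conjugate_iff:
  "h \<in> carrier G \<Longrightarrow> x \<in> (inv h <# U) #> h \<longleftrightarrow> x \<in> carrier G \<and> h \<otimes> x \<otimes> inv h \<in> U"
proof
  assume h: "h \<in> carrier G"
  show "x \<in> carrier G \<and> h \<otimes> x \<otimes> inv h \<in> U" if x: "x \<in> (inv h <# U) #> h"
  proof -
    obtain u where "u \<in> U" "x = inv h \<otimes> u \<otimes> h"
      using x by (auto simp: l_coset_def r_coset_def)
    moreover from this h have "h \<otimes> x \<otimes> inv h = u"
      by (simp add: m_assoc inv_solve_left) (simp flip: m_assoc)
    ultimately show ?thesis using h by simp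
  qed
  show "x \<in> (inv h <# U) #> h" if x: "x \<in> carrier G \<and> h \<otimes> x \<otimes> inv h \<in> U"
  proof -
    have "inv h \<otimes> (h \<otimes> x \<otimes> inv h) \<otimes> h = x"
      using h x by (simp add: m_assoc) (simp flip: m_assoc)
    then show ?thesis using x by (force simp: l_coset_def r_coset_def)
  qed
qed

text \<open>
  Sort the elements of \<open>V \<inter> inv h U h\<close> by their coset of \<open>N\<close>.  By the third condition of a James triple,
  every coset contains equally many of them, so the sum is a multiple of the sum over \<open>V/N\<close>.
\<close>

lemma sum_f_conjugate:
  assumes h: "h \<in> carrier G" "h \<notin> U <#> V"
  shows "(\<Sum>w\<in>V \<inter> ((inv h <# U) #> h). f w) = 0"
proof -
  let ?W = "V \<inter> ((inv h <# U) #> h)"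
  have "(\<Sum>w\<in>?W. f w) = (\<Sum>A\<in>cosets_N. \<Sum>w | w \<in> ?W \<and> w <# N = A. f w)"
    by (rule sum.group[symmetric]) (auto simp: finite_V cosets_N_def)
  also have "\<dots> = (\<Sum>A\<in>cosets_N. of_nat (card (N \<inter> ((inv h <# U) #> h))) * f_coset A)"
  proof (rule sum.cong)
    fix A assume "A \<in> cosets_N"
    then obtain w where w: "w \<in> V" "A = w <# N" by (auto simp: cosets_N_def)
    have "{v \<in> ?W. v <# N = A} = A \<inter> ((inv h <# U) #> h)"
    proof (intro equalityI subsetI)
      fix v assume v: "v \<in> {v \<in> ?W. v <# N = A}"
      then have "v \<in> v <# N" by (auto simp: l_coset_def intro!: bexI[of _ \<one>])
      then show "v \<in> A \<inter> ((inv h <# U) #> h)" using v by auto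
    next
      fix v assume v: "v \<in> A \<inter> ((inv h <# U) #> h)"
      then have "w <# N = v <# N"
        using w by (intro l_repr_independence[OF _ _ N_subgroup]) auto
      moreover have "v \<in> V" using v w N_subset_V by (auto simp: l_coset_def)
      ultimately show "v \<in> {v \<in> ?W. v <# N = A}" using v w by auto
    qed
    then have "(\<Sum>v | v \<in> ?W \<and> v <# N = A. f v) = (\<Sum>v\<in>A \<inter> ((inv h <# U) #> h). f v)" by simp
    also have "\<dots> = (\<Sum>v\<in>A \<inter> ((inv h <# U) #> h). f_coset A)"
      using w by (intro sum.cong) (auto simp: f_coset_eq f_lcoset)
    also have "\<dots> = of_nat (card (N \<inter> ((inv h <# U) #> h))) * f_coset A"
      using james h w by (simp add: james_triple_def)
    finally show "(\<Sum>v | v \<in> ?W \<and> v <# N = A. f v) =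
      of_nat (card (N \<inter> ((inv h <# U) #> h))) * f_coset A" .
  qed simp
  also have "\<dots> = 0" by (simp add: sum_f_coset flip: sum_distrib_left)
  finally show ?thesis .
qed

section \<open>The generator and the form\<close>

sublocale cosets: right_action G "rcosets U" "\<lambda>C g. C #> g"
proof
  fix C g h assume C: "C \<in> rcosets U"
  then obtain a where a: "a \<in> carrier G" "C = U #> a" by (auto simp: RCOSETS_def)
  show "C #> \<one> = C" using a by (simp add: coset_mult_assoc U.subset)
  assume g: "g \<in> carrier G"
  show "C #> g \<in> rcosets U" using a g by (simp add: coset_mult_assoc U.subset rcosetsI)
  assume "h \<in> carrier G"
  then show "C #> (g \<otimes> h) = C #> g #> h" using a g by (simp add: coset_mult_assoc U.subset m_assoc)
qed

abbreviation M :: "('k, 'g set \<Rightarrow> 'k, 'g) kG_module" where "M \<equiv> coset_module G U"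

abbreviation gen :: "'g set \<Rightarrow> 'k" where "gen \<equiv> james_generator G U V f"

sublocale M: kG_module G M
  unfolding coset_module_def by (rule cosets.kG_module_perm)

lemma finite_rcosets: "finite (rcosets U)"
  using finite_G by (auto simp: RCOSETS_def)

lemma M_carrier: "x \<in> carrier M \<longleftrightarrow> {C. x C \<noteq> 0} \<subseteq> rcosets U"
  using finite_subset[OF _ finite_rcosets] by (auto simp: coset_module_def perm_module_carrier)

lemma M_sels [simp]:
  "x \<oplus>\<^bsub>M\<^esub> y = (\<lambda>C. x C + y C)" "\<zero>\<^bsub>M\<^esub> = (\<lambda>_. 0)" "a \<odot>\<^bsub>M\<^esub> x = (\<lambda>C. a * x C)"
  by (simp_all add: coset_module_def)

lemma M_gact: "x \<star>\<^bsub>M\<^esub> g = (\<lambda>C. if C \<in> rcosets U then x (C #> inv g) else 0)"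
  by (simp add: coset_module_def perm_module_gact)

lemma gen_eq: "gen C = (\<Sum>v | v \<in> V \<and> U #> v = C. f v)"
proof -
  have "gen C = (\<Sum>v\<in>V. if U #> v = C then f v else 0)"
    unfolding james_generator_def by (rule sum.cong) (auto simp: basis_elem_def)
  also have "\<dots> = (\<Sum>v | v \<in> V \<and> U #> v = C. f v)"
    by (rule sum.inter_filter[symmetric]) (rule finite_V)
  finally show ?thesis .
qed

lemma gen_in: "gen \<in> carrier M"
proof -
  have "C \<in> rcosets U" if C: "gen C \<noteq> 0" for C
  proof -
    obtain v where "v \<in> V" "U #> v = C"
      using C unfolding gen_eq by (auto elim!: sum.not_neutral_contains_not_neutral)
    then show ?thesis using rcosetsI[OF U.subset] by auto
  qed
  then show ?thesis by (auto simp: M_carrier)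
qed

text \<open>
  The left-hand side is the coefficient of \<open>D\<kappa>\<close> at \<open>C\<close>.  For \<open>D = Uw\<close> with \<open>w\<close> in \<open>V\<close>, substituting
  \<open>inv w * v\<close> for \<open>v\<close> gives \<open>D\<kappa> = f (inv w) * e\<close>.  Otherwise \<open>D = Uh\<close> with \<open>h\<close> outside \<open>UV\<close>; the elements
  \<open>w\<close> of \<open>V\<close> with \<open>Dw = Dv\<close> form the coset of \<open>V \<inter> inv h U h\<close> by \<open>v\<close>, over which \<open>f\<close> sums to zero.
\<close>

lemma sum_translate:
  assumes D: "D \<in> rcosets U"
  shows "\<exists>\<mu>. \<forall>C. (\<Sum>v | v \<in> V \<and> D #> v = C. f v) = \<mu> * gen C"
proof -
  obtain h where h: "h \<in> carrier G" "D = U #> h" using D by (auto simp: RCOSETS_def)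
  show ?thesis
  proof (cases "h \<in> U <#> V")
    case True
    then obtain u w where uw: "u \<in> U" "w \<in> V" "h = u \<otimes> w" by (auto simp: set_mult_def)
    then have D_eq: "D = U #> w"
      using h coset_mult_assoc[of U u w] U.subset by (simp add: U.rcos_const)
    have "(\<Sum>v | v \<in> V \<and> D #> v = C. f v) = f (inv w) * gen C" for C
    proof -
      have "(\<Sum>v | v \<in> V \<and> D #> v = C. f v) = (\<Sum>v | v \<in> V \<and> U #> v = C. f (inv w) * f v)"
        by (rule sum.reindex_bij_witness[where i = "\<lambda>v. inv w \<otimes> v" and j = "\<lambda>v. w \<otimes> v"])
           (use uw in \<open>auto simp: D_eq coset_mult_assoc U.subset f_mult f_inv f_nonzero simp flip: m_assoc\<close>)
      then show ?thesis by (simp add: gen_eq sum_distrib_left)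
    qed
    then show ?thesis by blast
  next
    case False
    have "(\<Sum>v | v \<in> V \<and> D #> v = C. f v) = 0" for C
    proof (cases "\<exists>v\<in>V. D #> v = C")
      case True
      then obtain v where v: "v \<in> V" "C = U #> (h \<otimes> v)"
        using h by (auto simp: coset_mult_assoc U.subset)
      have iff: "D #> w = C \<longleftrightarrow> w \<otimes> inv v \<in> (inv h <# U) #> h" if w: "w \<in> V" for w
      proof -
        have "D #> w = C \<longleftrightarrow> U #> (h \<otimes> w) = U #> (h \<otimes> v)"
          using h v w by (simp add: coset_mult_assoc U.subset)
        also have "\<dots> \<longleftrightarrow> (h \<otimes> w) \<otimes> inv (h \<otimes> v) \<in> U"
        proof -
          have hw: "h \<otimes> w \<in> carrier G" "h \<otimes> v \<in> carrier G" using h v w by auto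
          have "U #> (h \<otimes> w) = U #> (h \<otimes> v) \<longleftrightarrow> h \<otimes> w \<in> U #> (h \<otimes> v)"
            using repr_independence[OF _ hw(2) U_subgroup] rcos_self[OF hw(1) U_subgroup] by metis
          then show ?thesis using U.rcos_module[OF is_group hw(2,1)] by simp
        qed
        also have "\<dots> \<longleftrightarrow> w \<otimes> inv v \<in> (inv h <# U) #> h"
          using h v w by (simp add: conjugate_iff inv_mult_group m_assoc)
        finally show ?thesis .
      qed
      have "(\<Sum>w | w \<in> V \<and> D #> w = C. f w) = (\<Sum>w\<in>V \<inter> ((inv h <# U) #> h). f v * f w)"
        by (rule sum.reindex_bij_witness[where i = "\<lambda>w. w \<otimes> v" and j = "\<lambda>w. w \<otimes> inv v"])
           (use v iff in \<open>auto simp: m_assoc f_mult f_inv f_nonzero\<close>)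
      then show ?thesis using sum_f_conjugate[OF h(1) False] by (simp flip: sum_distrib_left)
    next
      case False
      then have "{v. v \<in> V \<and> D #> v = C} = {}" by auto
      then show ?thesis by (simp only: sum.empty)
    qed
    then show ?thesis by (intro exI[of _ 0]) simp
  qed
qed

text \<open>
  Expand \<open>x\<close> in the basis of cosets and apply the preceding lemma to each of them.
\<close>

lemma kappa_in_line:
  assumes x: "x \<in> carrier M"
  shows "\<exists>a. (\<lambda>C. \<Sum>v\<in>V. f v * (x \<star>\<^bsub>M\<^esub> v) C) = (\<lambda>C. a * gen C)"
proof -
  obtain \<mu> where \<mu>: "\<And>D C. D \<in> rcosets U \<Longrightarrow> (\<Sum>v | v \<in> V \<and> D #> v = C. f v) = \<mu> D * gen C"
    using sum_translate by metis
  have "(\<Sum>v\<in>V. f v * (x \<star>\<^bsub>M\<^esub> v) C) = (\<Sum>D\<in>rcosets U. x D * \<mu> D) * gen C" for C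
  proof (cases "C \<in> rcosets U")
    case True
    have "(x \<star>\<^bsub>M\<^esub> v) C = (\<Sum>D\<in>rcosets U. if D #> v = C then x D else 0)" if v: "v \<in> V" for v
    proof -
      have "(\<Sum>D\<in>rcosets U. if D #> v = C then x D else 0) =
          (\<Sum>D\<in>rcosets U. if D = C #> inv v then x D else 0)"
        by (rule sum.cong) (use True v in auto)
      also have "\<dots> = (x \<star>\<^bsub>M\<^esub> v) C"
        using True v finite_rcosets cosets.act_closed[of C "inv v"] by (simp add: M_gact)
      finally show ?thesis by simp
    qed
    then have "(\<Sum>v\<in>V. f v * (x \<star>\<^bsub>M\<^esub> v) C) =
        (\<Sum>v\<in>V. \<Sum>D\<in>rcosets U. x D * (if D #> v = C then f v else 0))"
      by (auto simp: sum_distrib_left intro!: sum.cong)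
    also have "\<dots> = (\<Sum>D\<in>rcosets U. x D * (\<Sum>v\<in>V. if D #> v = C then f v else 0))"
      by (subst sum.swap) (simp add: sum_distrib_left)
    also have "\<dots> = (\<Sum>D\<in>rcosets U. x D * (\<mu> D * gen C))"
      by (rule sum.cong) (simp_all add: sum.inter_filter[OF finite_V, symmetric] \<mu>)
    finally show ?thesis by (simp add: sum_distrib_right mult.assoc)
  next
    case False
    then have "gen C = 0" using gen_in by (auto simp: M_carrier)
    then show ?thesis using False by (simp add: M_gact)
  qed
  then show ?thesis by blast
qed

lemma \<alpha>_add: "\<alpha> (a + b) = \<alpha> a + \<alpha> b" and \<alpha>_mult: "\<alpha> (a * b) = \<alpha> a * \<alpha> b" and \<alpha>_one: "\<alpha> 1 = 1"
  using \<alpha>_iso by (auto simp: ring_iso_def ring_hom_def)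

lemma \<alpha>_zero: "\<alpha> 0 = 0"
  using \<alpha>_add[of 0 0] by (metis add_0 add_cancel_right_right)

lemma \<alpha>_sum: "\<alpha> (sum t I) = (\<Sum>i\<in>I. \<alpha> (t i))"
  by (induction I rule: infinite_finite_induct) (auto simp: \<alpha>_zero \<alpha>_add)

abbreviation form :: "('g set \<Rightarrow> 'k) \<Rightarrow> ('g set \<Rightarrow> 'k) \<Rightarrow> 'k" where "form \<equiv> coset_form G \<alpha> U"

lemma form_simps [simp]:
  "form (\<lambda>C. x C + y C) z = form x z + form y z" "form (\<lambda>C. a * x C) z = a * form x z"
  "form z (\<lambda>C. x C + y C) = form z x + form z y" "form z (\<lambda>C. a * x C) = \<alpha> a * form z x"
  "form (\<lambda>_. 0) z = 0" "form z (\<lambda>_. 0) = 0"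
  by (simp_all add: coset_form_def \<alpha>_add \<alpha>_mult \<alpha>_zero algebra_simps sum.distrib sum_distrib_left)

lemma form_gact:
  assumes g: "g \<in> carrier G" shows "form (x \<star>\<^bsub>M\<^esub> g) (y \<star>\<^bsub>M\<^esub> g) = form x y"
  unfolding coset_form_def
  by (rule sum.reindex_bij_witness[where i = "\<lambda>C. C #> g" and j = "\<lambda>C. C #> inv g"])
     (use g in \<open>auto simp: M_gact cosets.act_closed\<close>)

lemma form_gact_left:
  assumes "y \<in> carrier M" "g \<in> carrier G" shows "form (x \<star>\<^bsub>M\<^esub> g) y = form x (y \<star>\<^bsub>M\<^esub> inv g)"
  using form_gact[of g x "y \<star>\<^bsub>M\<^esub> inv g"] assms
  by (simp add: M.gact_mult[symmetric] M.gact_one)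

text \<open>
  This is \<open>[y, U\<kappa>] = [y\<kappa>, U]\<close>, the self-adjointness of \<open>\<kappa>\<close>: moving \<open>v\<close> to the other side of the form
  inverts it, and so does \<open>\<alpha>\<close> to the scalar \<open>f v\<close>.
\<close>

lemma form_gen: "form y gen = (\<Sum>v\<in>V. f v * (y \<star>\<^bsub>M\<^esub> v) U)"
proof -
  have U_in: "U \<in> rcosets U" using rcosetsI[OF U.subset one_closed] U.subset by simp
  have coset_in: "U #> v \<in> rcosets U" if "v \<in> V" for v using rcosetsI[OF U.subset] that by simp
  have \<alpha>f: "\<alpha> (f v) = f (inv v)" if "v \<in> V" for v
    using fits that by (simp add: fits_def f_inv)
  have "form y gen = (\<Sum>C\<in>rcosets U. \<Sum>v\<in>V. if C = U #> v then f (inv v) * y C else 0)"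
    unfolding coset_form_def james_generator_def \<alpha>_sum sum_distrib_left
    by (intro sum.cong) (auto simp: \<alpha>_mult \<alpha>f basis_elem_def \<alpha>_zero \<alpha>_one)
  also have "\<dots> = (\<Sum>v\<in>V. f (inv v) * y (U #> v))"
    by (subst sum.swap) (rule sum.cong, auto simp: finite_rcosets coset_in)
  also have "\<dots> = (\<Sum>v\<in>V. f v * (y \<star>\<^bsub>M\<^esub> v) U)"
    by (rule sum.reindex_bij_witness[where i = "\<lambda>v. inv v" and j = "\<lambda>v. inv v"])
       (auto simp: M_gact U_in)
  finally show ?thesis .
qed

section \<open>The quotient by the radical of the form\<close>

abbreviation S :: "('g set \<Rightarrow> 'k) set" where "S \<equiv> james_submodule G U V f"

lemma S_submodule: "kG_submodule S G M"
  unfolding james_submodule_def by (rule M.kG_submodule_span) (use gen_in in simp)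

lemma gen_in_S: "gen \<in> S"
  unfolding james_submodule_def using subset_kG_span[of "{gen}" G M] by simp

lemma S_least: "\<lbrakk>kG_submodule P G M; gen \<in> P\<rbrakk> \<Longrightarrow> S \<subseteq> P"
  unfolding james_submodule_def by (rule kG_span_subset) auto

lemma orth_submodule: "kG_submodule (orth G \<alpha> U S) G M"
proof (rule M.kG_submoduleI)
  note D = M.kG_submoduleD[OF S_submodule]
  show "x \<star>\<^bsub>M\<^esub> g \<in> orth G \<alpha> U S" if "x \<in> orth G \<alpha> U S" "g \<in> carrier G" for x g
    using that D(1,5) by (auto simp: orth_def form_gact_left M.gact_closed subset_iff)
qed (use M.M.add.m_closed M.M.zero_closed M.smult_in in \<open>auto simp: orth_def\<close>)

text \<open>
  The form is invariant and \<open>S\<close> is generated by \<open>gen\<close>, so orthogonality to \<open>S\<close> can be tested against the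
  translates of \<open>gen\<close>, equivalently by testing the translates of \<open>x\<close> against \<open>gen\<close>.
\<close>

lemma orthI:
  assumes x: "x \<in> carrier M" and *: "\<And>g. g \<in> carrier G \<Longrightarrow> form (x \<star>\<^bsub>M\<^esub> g) gen = 0"
  shows "x \<in> orth G \<alpha> U S"
proof -
  let ?P = "{s \<in> carrier M. \<forall>g\<in>carrier G. form (x \<star>\<^bsub>M\<^esub> g) s = 0}"
  have "kG_submodule ?P G M"
  proof (rule M.kG_submoduleI)
    show "s \<star>\<^bsub>M\<^esub> h \<in> ?P" if s: "s \<in> ?P" and h: "h \<in> carrier G" for s h
    proof -
      have "form (x \<star>\<^bsub>M\<^esub> g) (s \<star>\<^bsub>M\<^esub> h) = form (x \<star>\<^bsub>M\<^esub> (g \<otimes> inv h)) s" if "g \<in> carrier G" for g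
        using form_gact_left[of s "inv h" "x \<star>\<^bsub>M\<^esub> g"] x s h that by (simp add: M.gact_mult)
      then show ?thesis using s h by (simp add: M.gact_closed)
    qed
  qed (use M.M.add.m_closed M.M.zero_closed M.smult_in in auto)
  then have "S \<subseteq> ?P" by (rule S_least) (use gen_in * in simp)
  then have "form (x \<star>\<^bsub>M\<^esub> \<one>) s = 0" if "s \<in> S" for s using that by blast
  then show ?thesis using x by (simp add: orth_def M.gact_one)
qed

definition Q :: "('k, ('g set \<Rightarrow> 'k) set, 'g) kG_module" where
  "Q = kG_quotient (M\<lparr>carrier := S\<rparr>) (S \<inter> orth G \<alpha> U S)"

text \<open>
  If \<open>gen\<close> lies in the orthogonal space of \<open>S\<close>, so does \<open>S\<close>, and the quotient is zero.  Otherwise the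
  criterion of \<open>rank_one_kG_module\<close> applies.  For nondegeneracy, suppose that \<open>xg\<kappa>\<close> vanishes in the quotient.  In
  \<open>M\<close> it is a multiple of \<open>gen\<close> that lies in the orthogonal space, hence it is zero already in \<open>M\<close>, and its
  coefficient at \<open>U\<close> is \<open>[xg, gen]\<close>; if this holds for all \<open>g\<close>, \<open>x\<close> is orthogonal to \<open>S\<close>.
\<close>

theorem absolutely_irreducible_or_zero: "absolutely_irreducible_kG_module G Q \<or> carrier Q = {\<zero>\<^bsub>Q\<^esub>}"
proof -
  let ?R = "S \<inter> orth G \<alpha> U S" and ?MS = "M\<lparr>carrier := S\<rparr>"
  interpret MS: kG_module G ?MS by (rule M.kG_module_restrict[OF S_submodule])
  have R: "kG_submodule ?R G ?MS"
    unfolding M.kG_submodule_restrict_iff[OF S_submodule]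
    using M.kG_submodule_Int[OF S_submodule orth_submodule] by simp
  note Q_sels = MS.kG_quotient_sels[OF R, folded Q_def]
  note Q_simps = MS.coset_simps[OF R, folded Q_def, simplified]
  note SD = M.kG_submoduleD[OF S_submodule]
  show ?thesis
  proof (cases "gen \<in> orth G \<alpha> U S")
    case True
    then have "S \<subseteq> orth G \<alpha> U S" by (rule S_least[OF orth_submodule])
    then have "?R +>\<^bsub>?MS\<^esub> x = ?R" if "x \<in> S" for x
      using MS.coset_eq_self_iff[OF R, of x] that by auto
    then have "carrier Q = {\<zero>\<^bsub>Q\<^esub>}" using gen_in_S by (auto simp: Q_sels)
    then show ?thesis ..
  next
    case False
    have kappa: "finsum ?MS (\<lambda>v. f v \<odot>\<^bsub>?MS\<^esub> (x \<star>\<^bsub>?MS\<^esub> v)) V = (\<lambda>C. \<Sum>v\<in>V. f v * (x \<star>\<^bsub>M\<^esub> v) C)"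
      if x: "x \<in> S" for x
    proof -
      have "finsum ?MS (\<lambda>v. f v \<odot>\<^bsub>?MS\<^esub> (x \<star>\<^bsub>?MS\<^esub> v)) V = (\<lambda>C. \<Sum>v\<in>V. (f v \<odot>\<^bsub>?MS\<^esub> (x \<star>\<^bsub>?MS\<^esub> v)) C)"
        unfolding coset_module_def
        by (rule finsum_perm_module)
           (use MS.kG_module_axioms finite_V SD(4,5) x in \<open>auto simp: coset_module_def\<close>)
      then show ?thesis by simp
    qed
    have kappa_Q: "(\<Oplus>\<^bsub>Q\<^esub>v\<in>V. f v \<odot>\<^bsub>Q\<^esub> ((?R +>\<^bsub>?MS\<^esub> x) \<star>\<^bsub>Q\<^esub> v)) =
        ?R +>\<^bsub>?MS\<^esub> (\<lambda>C. \<Sum>v\<in>V. f v * (x \<star>\<^bsub>M\<^esub> v) C)" if x: "x \<in> S" for x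
    proof -
      interpret Q: kG_module G Q unfolding Q_def by (rule MS.kG_module_quotient[OF R])
      have "(\<Oplus>\<^bsub>Q\<^esub>v\<in>V. f v \<odot>\<^bsub>Q\<^esub> ((?R +>\<^bsub>?MS\<^esub> x) \<star>\<^bsub>Q\<^esub> v)) =
          (\<Oplus>\<^bsub>Q\<^esub>v\<in>V. ?R +>\<^bsub>?MS\<^esub> (f v \<odot>\<^bsub>?MS\<^esub> (x \<star>\<^bsub>?MS\<^esub> v)))"
        by (rule Q.M.finsum_cong')
           (use x SD(4,5) in \<open>auto simp: Q_simps Q_sels\<close>)
      also have "\<dots> = ?R +>\<^bsub>?MS\<^esub> finsum ?MS (\<lambda>v. f v \<odot>\<^bsub>?MS\<^esub> (x \<star>\<^bsub>?MS\<^esub> v)) V"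
        unfolding Q_def by (rule MS.coset_finsum[OF R, symmetric]) (use x SD(4,5) in auto)
      finally show ?thesis unfolding kappa[OF x] .
    qed
    have "rank_one_kG_module G Q V f (?R +>\<^bsub>?MS\<^esub> gen)"
    proof (intro rank_one_kG_module.intro rank_one_kG_module_axioms.intro)
      show "kG_module G Q" unfolding Q_def by (rule MS.kG_module_quotient[OF R])
      show "finite (carrier G)" by (rule finite_G)
      show "V \<subseteq> carrier G" by (rule V.subset)
      show "?R +>\<^bsub>?MS\<^esub> gen \<in> carrier Q" using gen_in_S by (simp add: Q_sels)
      show "?R +>\<^bsub>?MS\<^esub> gen \<noteq> \<zero>\<^bsub>Q\<^esub>"
        using MS.coset_eq_self_iff[OF R, of gen] gen_in_S False by (simp add: Q_sels)
    next
      fix H assume H: "kG_submodule H G Q" and "?R +>\<^bsub>?MS\<^esub> gen \<in> H"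
      have "kG_submodule {x \<in> S. ?R +>\<^bsub>?MS\<^esub> x \<in> H} G ?MS"
        using MS.kG_submodule_preimage[OF R H[unfolded Q_def]] by simp
      then have "S \<subseteq> {x \<in> S. ?R +>\<^bsub>?MS\<^esub> x \<in> H}"
        using gen_in_S \<open>?R +>\<^bsub>?MS\<^esub> gen \<in> H\<close>
        by (intro S_least) (auto simp: M.kG_submodule_restrict_iff[OF S_submodule])
      moreover have "H \<subseteq> carrier Q"
        using kG_module.kG_submoduleD(1)[OF _ H] MS.kG_module_quotient[OF R] by (simp add: Q_def)
      ultimately show "H = carrier Q" by (auto simp: Q_sels)
    next
      fix y assume "y \<in> carrier Q"
      then obtain x where x: "x \<in> S" "y = ?R +>\<^bsub>?MS\<^esub> x" by (auto simp: Q_sels)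
      obtain a where "(\<lambda>C. \<Sum>v\<in>V. f v * (x \<star>\<^bsub>M\<^esub> v) C) = (\<lambda>C. a * gen C)"
        using kappa_in_line[of x] x SD(1) by auto
      then have "(\<Oplus>\<^bsub>Q\<^esub>v\<in>V. f v \<odot>\<^bsub>Q\<^esub> (y \<star>\<^bsub>Q\<^esub> v)) = a \<odot>\<^bsub>Q\<^esub> (?R +>\<^bsub>?MS\<^esub> gen)"
        using x gen_in_S by (simp add: kappa_Q Q_simps)
      then show "\<exists>a. (\<Oplus>\<^bsub>Q\<^esub>v\<in>V. f v \<odot>\<^bsub>Q\<^esub> (y \<star>\<^bsub>Q\<^esub> v)) = a \<odot>\<^bsub>Q\<^esub> (?R +>\<^bsub>?MS\<^esub> gen)" by blast
    next
      fix y assume "y \<in> carrier Q" and zero: "\<And>g. g \<in> carrier G \<Longrightarrow>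
        (\<Oplus>\<^bsub>Q\<^esub>v\<in>V. f v \<odot>\<^bsub>Q\<^esub> (y \<star>\<^bsub>Q\<^esub> g \<star>\<^bsub>Q\<^esub> v)) = \<zero>\<^bsub>Q\<^esub>"
      then obtain x where x: "x \<in> S" "y = ?R +>\<^bsub>?MS\<^esub> x" by (auto simp: Q_sels)
      have "form (x \<star>\<^bsub>M\<^esub> g) gen = 0" if g: "g \<in> carrier G" for g
      proof -
        have xg: "x \<star>\<^bsub>M\<^esub> g \<in> S" using SD(5) x g by simp
        then obtain a where a: "(\<lambda>C. \<Sum>v\<in>V. f v * (x \<star>\<^bsub>M\<^esub> g \<star>\<^bsub>M\<^esub> v) C) = (\<lambda>C. a * gen C)"
          using kappa_in_line[of "x \<star>\<^bsub>M\<^esub> g"] SD(1) by auto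
        have "?R +>\<^bsub>?MS\<^esub> (\<lambda>C. a * gen C) = ?R"
          using zero[OF g] x g kappa_Q[OF xg] by (simp add: Q_simps Q_sels a)
        then have "(\<lambda>C. a * gen C) \<in> ?R"
          using MS.coset_eq_self_iff[OF R, of "\<lambda>C. a * gen C"] SD(4)[OF gen_in_S, of a] by simp
        then have *: "(\<lambda>C. a * gen C) \<in> orth G \<alpha> U S" by simp
        have "a = 0"
        proof (rule ccontr)
          assume "a \<noteq> 0"
          then show False
            using M.kG_submoduleD(4)[OF orth_submodule *, of "inverse a"] False by (simp flip: mult.assoc)
        qed
        then show ?thesis using fun_cong[OF a, of U] by (simp add: form_gen)
      qed
      then have "x \<in> orth G \<alpha> U S" using x SD(1) by (intro orthI) auto
      then show "y = \<zero>\<^bsub>Q\<^esub>"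
        using MS.coset_eq_self_iff[OF R, of x] x by (simp add: Q_sels)
    qed
    then show ?thesis by (intro disjI1 rank_one_kG_module.absolutely_irreducible)
  qed
qed

end

theorem theorem17:
  fixes G :: "('g, 'b) monoid_scheme" and U V N :: "'g set" and k :: nat
    and \<alpha> :: "'k::field \<Rightarrow> 'k" and f :: "'g \<Rightarrow> 'k"
  assumes "group G" and "finite (carrier G)"
    and "\<alpha> \<in> ring_iso ring_of_type_algebra ring_of_type_algebra"
    and "james_triple G k U V N"
    and "f \<in> hom (G\<lparr>carrier := V\<rparr>) roots_of_unity"
    and "fits G \<alpha> V N f"
  shows "let S = james_submodule G U V f;
             Q = kG_quotient ((coset_module G U)\<lparr>carrier := S\<rparr>) (S \<inter> orth G \<alpha> U S)
         in absolutely_irreducible_kG_module G Q \<or> carrier Q = {\<zero>\<^bsub>Q\<^esub>}"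
proof -
  interpret fitted_james_triple G U V N k \<alpha> f
    using assms by (intro fitted_james_triple.intro fitted_james_triple_axioms.intro)
  show ?thesis
    using absolutely_irreducible_or_zero by (simp add: Let_def Q_def)
qed

end
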